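(* Let $\mathcal A\subseteq B(\mathcal H)$ be a von Neumann algebra and let $\tau:\mathcal A\to\mathcal A$ be a normal unital completely positive map. Let $\circ$ be the product of the peripheral Poisson boundary $\mathcal P(\tau)$. Then for $x,y\in\mathcal A$ with $\tau(x)=\lambda x$ and $\tau(y)=\mu y$, where $\lambda,\mu\in\mathbb T$, $$x\circ y=\text{s-}\lim_{n\to\infty}(\lambda\mu)^{-n}\tau^n(xy),$$ where the limit is in the strong operator topology. If there exists a faithful state on $\mathcal A$ left invariant by $\tau$, then $x\circ y=xy$.
   Context: All Hilbert spaces are complex and separable; $\mathbb T=\{z\in\mathbb C:|z|=1\}$. For Hilbert spaces $\mathcal H\subseteq\mathcal K$ with $p$ the orthogonal projection of $\mathcal K$ onto $\mathcal H$, an operator $x\in B(\mathcal H)$ is identified with $pxp\in B(\mathcal K)$. Minimal dilation: it is known that for every normal unital completely positive map $\tau$ on a von Neumann algebra $\mathcal A\subseteq B(\mathcal H)$ there is a triple $(\mathcal K,\mathcal B,\theta)$, unique up to unitary equivalence fixing $\mathcal H$ pointwise, such that: $\mathcal K\supseteq\mathcal H$ is a Hilbert space containing $\mathcal H$ as a closed subspace; $\mathcal B\subseteq B(\mathcal K)$ is a von Neumann algebra with $\mathcal A=p\mathcal Bp$ (so $p$ is the identity of $\mathcal A$); $\theta:\mathcal B\to\mathcal B$ is a normal unital $*$-endomorphism; $\tau^n(x)=p\theta^n(x)p$ for all $x\in\mathcal A$, $n\in\mathbb Z_+$; $\mathcal K$ is the closed linear span of $\{\theta^n(x_n)\cdots\theta(x_1)h: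 x_i\in\mathcal A,\ h\in\mathcal H,\ n\in\mathbb Z_+\}$; and $\mathcal B$ is the von Neumann algebra generated by $\{\theta^n(x):n\in\mathbb Z_+,x\in\mathcal A\}$. Peripheral Poisson boundary: $\mathcal P(\tau)$ is the operator norm closure of $\mathrm{span}\{x\in\mathcal A:\tau(x)=\lambda x\text{ for some }\lambda\in\mathbb T\}$, and $\mathcal P(\theta)$ is the operator norm closure of $\mathrm{span}\{x\in\mathcal B:\theta(x)=\lambda x\text{ for some }\lambda\in\mathbb T\}$, which is a unital $C^*$-algebra. The compression $T:\mathcal P(\theta)\to\mathcal P(\tau)$, $T(z)=pzp$, is an isometric bijection, and the product $x\circ y:=T(T^{-1}(x)T^{-1}(y))$ makes $\mathcal P(\tau)$ (with unchanged norm and involution) a unital $C^*$-algebra, called the peripheral Poisson boundary of $\tau$. A state $\phi$ is left invariant by $\tau$ if $\phi\circ\tau=\phi$ (composition of maps). *)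

theory Defs
  imports "HOL-Analysis.Analysis" "HOL-Library.Nonpos_Ints"
begin

section \<open>Complex Hilbert spaces\<close>

class scaleC =
  fixes scaleC :: "complex \<Rightarrow> 'a \<Rightarrow> 'a"  (infixr \<open>*\<^sub>C\<close> 75)

class complex_vector = real_vector + scaleC +
  assumes scaleC_add_right: "c *\<^sub>C (x + y) = c *\<^sub>C x + c *\<^sub>C y"
    and scaleC_add_left: "(c + d) *\<^sub>C x = c *\<^sub>C x + d *\<^sub>C x"
    and scaleC_scaleC: "c *\<^sub>C (d *\<^sub>C x) = (c * d) *\<^sub>C x"
    and scaleC_of_real: "complex_of_real r *\<^sub>C x = r *\<^sub>R x"

lemma vector_space_scaleC: "vector_space (scaleC :: complex \<Rightarrow> 'a \<Rightarrow> 'a::complex_vector)"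
proof
  show "1 *\<^sub>C x = x" for x :: 'a
    using scaleC_of_real[of 1 x] by simp
qed (simp_all add: scaleC_add_right scaleC_add_left scaleC_scaleC)

text \<open>The inner product is linear in the second and conjugate linear in the first argument.
  Completeness comes from \<^class>\<open>banach\<close>. A separable Hilbert space is a type of the sort
  \<open>{complex_hilbert_space, second_countable_topology}\<close>: for metric spaces separability and
  second countability agree.\<close>

class complex_hilbert_space = complex_vector + banach +
  fixes cinner :: "'a \<Rightarrow> 'a \<Rightarrow> complex"
  assumes cinner_add_right: "cinner x (y + z) = cinner x y + cinner x z"
    and cinner_scaleC_right: "cinner x (c *\<^sub>C y) = c * cinner x y"
    and cinner_commute: "cinner x y = cnj (cinner y x)"
    and cinner_self: "cinner x x = complex_of_real ((norm x)\<^sup>2)"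

instantiation complex :: complex_hilbert_space
begin

definition scaleC_complex :: "complex \<Rightarrow> complex \<Rightarrow> complex"
  where "scaleC_complex c x = c * x"

definition cinner_complex :: "complex \<Rightarrow> complex \<Rightarrow> complex"
  where "cinner_complex x y = cnj x * y"

instance
proof
  show "cinner x x = complex_of_real ((norm x)\<^sup>2)" for x :: complex
    unfolding cinner_complex_def by (subst complex_norm_square) (simp add: mult.commute)
qed (simp_all add: scaleC_complex_def cinner_complex_def algebra_simps scaleR_conv_of_real)

end

lemma norm_scaleC: "norm (c *\<^sub>C x) = norm c * norm (x :: 'a::complex_hilbert_space)"
proof -
  have "complex_of_real ((norm (c *\<^sub>C x))\<^sup>2) = cinner (c *\<^sub>C x) (c *\<^sub>C x)"
    by (rule cinner_self [symmetric])
  also have "\<dots> = c * cnj (cinner x (c *\<^sub>C x))"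
    by (simp only: cinner_scaleC_right cinner_commute [of "c *\<^sub>C x" x])
  also have "\<dots> = (c * cnj c) * complex_of_real ((norm x)\<^sup>2)"
    by (simp add: cinner_scaleC_right cinner_self)
  also have "\<dots> = complex_of_real ((norm c * norm x)\<^sup>2)"
    by (simp add: complex_norm_square [symmetric] power_mult_distrib)
  finally have "(norm (c *\<^sub>C x))\<^sup>2 = (norm c * norm x)\<^sup>2"
    using of_real_eq_iff by blast
  then show ?thesis
    by (simp add: power2_eq_iff_nonneg)
qed

lemma bounded_linear_scaleC_right:
  "bounded_linear (\<lambda>x :: 'a::complex_hilbert_space. c *\<^sub>C x)"
proof (rule bounded_linear_intro [where K = "norm c"])
  show "c *\<^sub>C (r *\<^sub>R x) = r *\<^sub>R (c *\<^sub>C x)" for r and x :: 'a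
    by (simp add: scaleC_of_real [symmetric] scaleC_scaleC mult.commute)
qed (simp_all add: scaleC_add_right norm_scaleC)

section \<open>Bounded operators\<close>

text \<open>Elements of the type \<open>'h \<Rightarrow>\<^sub>L 'k\<close> are bounded and real-linear; bounded complex-linear
  operators are singled out below. The norm of this type is the operator norm.\<close>

instantiation blinfun :: (real_normed_vector, complex_hilbert_space) complex_vector
begin

lift_definition scaleC_blinfun :: "complex \<Rightarrow> 'a \<Rightarrow>\<^sub>L 'b \<Rightarrow> 'a \<Rightarrow>\<^sub>L 'b"
  is "\<lambda>c f x. c *\<^sub>C f x"
  by (rule bounded_linear_compose [OF bounded_linear_scaleC_right])

instance
  by standard
    (transfer, simp add: fun_eq_iff scaleC_add_right scaleC_add_left scaleC_scaleC scaleC_of_real)+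

end

definition bounded_ops :: "('h::complex_hilbert_space \<Rightarrow>\<^sub>L 'k::complex_hilbert_space) set"
  where "bounded_ops = {a :: 'h \<Rightarrow>\<^sub>L 'k. \<forall>c x. a (c *\<^sub>C x) = c *\<^sub>C a x}"

definition cadj ::
  "('h::complex_hilbert_space \<Rightarrow>\<^sub>L 'k::complex_hilbert_space) \<Rightarrow> 'k \<Rightarrow>\<^sub>L 'h"
  where "cadj a = (THE b :: 'k \<Rightarrow>\<^sub>L 'h. \<forall>x y. cinner (a x) y = cinner x (b y))"

definition positive_op :: "('h::complex_hilbert_space \<Rightarrow>\<^sub>L 'h) \<Rightarrow> bool"
  where "positive_op a \<longleftrightarrow> a \<in> bounded_ops \<and> (\<forall>x. cinner x (a x) \<in> \<real>\<^sub>\<ge>\<^sub>0)"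

definition op_le :: "('h::complex_hilbert_space \<Rightarrow>\<^sub>L 'h) \<Rightarrow> ('h \<Rightarrow>\<^sub>L 'h) \<Rightarrow> bool"
  where "op_le a b \<longleftrightarrow> positive_op (b - a)"

definition cspan :: "'a::complex_vector set \<Rightarrow> 'a set"
  where "cspan = module.span scaleC"

definition clinear_on :: "'a::complex_vector set \<Rightarrow> ('a \<Rightarrow> 'b::complex_vector) \<Rightarrow> bool"
  where "clinear_on M f \<longleftrightarrow>
    (\<forall>a\<in>M. \<forall>b\<in>M. f (a + b) = f a + f b) \<and> (\<forall>c. \<forall>a\<in>M. f (c *\<^sub>C a) = c *\<^sub>C f a)"

section \<open>Von Neumann algebras and maps between them\<close>

definition von_neumann_algebra :: "('h::complex_hilbert_space \<Rightarrow>\<^sub>L 'h) set \<Rightarrow> bool"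
  where "von_neumann_algebra M \<longleftrightarrow>
    M \<subseteq> bounded_ops \<and>
    id_blinfun \<in> M \<and>
    (\<forall>a\<in>M. \<forall>b\<in>M. a + b \<in> M) \<and>
    (\<forall>c. \<forall>a\<in>M. c *\<^sub>C a \<in> M) \<and>
    (\<forall>a\<in>M. \<forall>b\<in>M. a o\<^sub>L b \<in> M) \<and>
    (\<forall>a\<in>M. cadj a \<in> M) \<and>
    closedin strong_operator_topology M"

definition generated_vna ::
  "('h::complex_hilbert_space \<Rightarrow>\<^sub>L 'h) set \<Rightarrow> ('h \<Rightarrow>\<^sub>L 'h) set"
  where "generated_vna S = \<Inter>{M. von_neumann_algebra M \<and> S \<subseteq> M}"

definition is_sup_in ::
  "('h::complex_hilbert_space \<Rightarrow>\<^sub>L 'h) set \<Rightarrow> ('h \<Rightarrow>\<^sub>L 'h) set \<Rightarrow> ('h \<Rightarrow>\<^sub>L 'h) \<Rightarrow> bool"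
  where "is_sup_in M D s \<longleftrightarrow>
    s \<in> M \<and> (\<forall>d\<in>D. op_le d s) \<and> (\<forall>u\<in>M. (\<forall>d\<in>D. op_le d u) \<longrightarrow> op_le s u)"

text \<open>Normality of a positive map: suprema of bounded increasing nets of self-adjoint elements,
  here given as upward directed sets, are preserved.\<close>

definition normal_map ::
  "('h::complex_hilbert_space \<Rightarrow>\<^sub>L 'h) set \<Rightarrow> (('h \<Rightarrow>\<^sub>L 'h) \<Rightarrow> 'h \<Rightarrow>\<^sub>L 'h) \<Rightarrow> bool"
  where "normal_map M f \<longleftrightarrow>
    (\<forall>D s. D \<subseteq> M \<and> D \<noteq> {} \<and> (\<forall>d\<in>D. cadj d = d) \<and>
      (\<forall>a\<in>D. \<forall>b\<in>D. \<exists>c\<in>D. op_le a c \<and> op_le b c) \<and> is_sup_in M D s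
      \<longrightarrow> is_sup_in M (f ` D) (f s))"

text \<open>Positivity of the operator matrix \<open>(a i j)\<close>, \<open>i, j < n\<close>, acting on the direct sum of \<open>n\<close>
  copies of the Hilbert space.\<close>

definition positive_op_matrix ::
  "nat \<Rightarrow> (nat \<Rightarrow> nat \<Rightarrow> 'h::complex_hilbert_space \<Rightarrow>\<^sub>L 'h) \<Rightarrow> bool"
  where "positive_op_matrix n a \<longleftrightarrow>
    (\<forall>v :: nat \<Rightarrow> 'h. (\<Sum>i<n. \<Sum>j<n. cinner (v i) (a i j (v j))) \<in> \<real>\<^sub>\<ge>\<^sub>0)"

definition completely_positive ::
  "('h::complex_hilbert_space \<Rightarrow>\<^sub>L 'h) set \<Rightarrow> (('h \<Rightarrow>\<^sub>L 'h) \<Rightarrow> 'h \<Rightarrow>\<^sub>L 'h) \<Rightarrow> bool"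
  where "completely_positive M f \<longleftrightarrow>
    (\<forall>n a. (\<forall>i<n. \<forall>j<n. a i j \<in> M) \<and> positive_op_matrix n a
      \<longrightarrow> positive_op_matrix n (\<lambda>i j. f (a i j)))"

definition normal_ucp_map ::
  "('h::complex_hilbert_space \<Rightarrow>\<^sub>L 'h) set \<Rightarrow> (('h \<Rightarrow>\<^sub>L 'h) \<Rightarrow> 'h \<Rightarrow>\<^sub>L 'h) \<Rightarrow> bool"
  where "normal_ucp_map M f \<longleftrightarrow>
    f ` M \<subseteq> M \<and> clinear_on M f \<and> completely_positive M f \<and> f id_blinfun = id_blinfun \<and>
    normal_map M f"

definition normal_unital_star_endomorphism ::
  "('h::complex_hilbert_space \<Rightarrow>\<^sub>L 'h) set \<Rightarrow> (('h \<Rightarrow>\<^sub>L 'h) \<Rightarrow> 'h \<Rightarrow>\<^sub>L 'h) \<Rightarrow> bool"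
  where "normal_unital_star_endomorphism M f \<longleftrightarrow>
    f ` M \<subseteq> M \<and> clinear_on M f \<and> (\<forall>a\<in>M. \<forall>b\<in>M. f (a o\<^sub>L b) = f a o\<^sub>L f b) \<and>
    (\<forall>a\<in>M. f (cadj a) = cadj (f a)) \<and> f id_blinfun = id_blinfun \<and> normal_map M f"

definition faithful_state ::
  "('h::complex_hilbert_space \<Rightarrow>\<^sub>L 'h) set \<Rightarrow> (('h \<Rightarrow>\<^sub>L 'h) \<Rightarrow> complex) \<Rightarrow> bool"
  where "faithful_state M \<phi> \<longleftrightarrow>
    clinear_on M \<phi> \<and> (\<forall>a\<in>M. positive_op a \<longrightarrow> \<phi> a \<in> \<real>\<^sub>\<ge>\<^sub>0) \<and> \<phi> id_blinfun = 1 \<and>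
    (\<forall>a\<in>M. positive_op a \<and> \<phi> a = 0 \<longrightarrow> a = 0)"

section \<open>The minimal dilation\<close>

text \<open>The inclusion of \<open>\<H>\<close> as a closed subspace of \<open>\<K>\<close> is a linear isometry \<open>V\<close>, so that
  \<open>p = V V\<^sup>*\<close>. Then \<open>x \<in> B(\<H>)\<close> is identified with \<open>V x V\<^sup>* \<in> B(\<K>)\<close>, and the operator in
  \<open>B(\<H>)\<close> identified with \<open>p z p\<close> is \<open>V\<^sup>* z V\<close>.\<close>

definition isometric_embedding ::
  "('h::complex_hilbert_space \<Rightarrow>\<^sub>L 'k::complex_hilbert_space) \<Rightarrow> bool"
  where "isometric_embedding V \<longleftrightarrow> V \<in> bounded_ops \<and> (\<forall>x. norm (V x) = norm x)"

definition ident ::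
  "('h::complex_hilbert_space \<Rightarrow>\<^sub>L 'k::complex_hilbert_space) \<Rightarrow> ('h \<Rightarrow>\<^sub>L 'h) \<Rightarrow> 'k \<Rightarrow>\<^sub>L 'k"
  where "ident V x = V o\<^sub>L x o\<^sub>L cadj V"

definition compress ::
  "('h::complex_hilbert_space \<Rightarrow>\<^sub>L 'k::complex_hilbert_space) \<Rightarrow> ('k \<Rightarrow>\<^sub>L 'k) \<Rightarrow> 'h \<Rightarrow>\<^sub>L 'h"
  where "compress V z = cadj V o\<^sub>L z o\<^sub>L V"

text \<open>\<open>dilation_word V \<theta> x n\<close> is the operator \<open>\<theta>\<^sup>n(x\<^sub>n) \<cdots> \<theta>(x\<^sub>1)\<close>; the value \<open>x 0\<close> is not
  used.\<close>

primrec dilation_word ::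
  "('h::complex_hilbert_space \<Rightarrow>\<^sub>L 'k::complex_hilbert_space) \<Rightarrow> (('k \<Rightarrow>\<^sub>L 'k) \<Rightarrow> 'k \<Rightarrow>\<^sub>L 'k) \<Rightarrow>
    (nat \<Rightarrow> 'h \<Rightarrow>\<^sub>L 'h) \<Rightarrow> nat \<Rightarrow> 'k \<Rightarrow>\<^sub>L 'k"
  where
    "dilation_word V \<theta> x 0 = id_blinfun"
  | "dilation_word V \<theta> x (Suc n) = (\<theta> ^^ Suc n) (ident V (x (Suc n))) o\<^sub>L dilation_word V \<theta> x n"

definition minimal_dilation ::
  "('h::complex_hilbert_space \<Rightarrow>\<^sub>L 'h) set \<Rightarrow> (('h \<Rightarrow>\<^sub>L 'h) \<Rightarrow> 'h \<Rightarrow>\<^sub>L 'h) \<Rightarrow>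
    ('h \<Rightarrow>\<^sub>L 'k::complex_hilbert_space) \<Rightarrow> ('k \<Rightarrow>\<^sub>L 'k) set \<Rightarrow> (('k \<Rightarrow>\<^sub>L 'k) \<Rightarrow> 'k \<Rightarrow>\<^sub>L 'k) \<Rightarrow> bool"
  where "minimal_dilation A \<tau> V B \<theta> \<longleftrightarrow>
    isometric_embedding V \<and>
    von_neumann_algebra B \<and>
    ident V ` A = (\<lambda>b. ident V id_blinfun o\<^sub>L b o\<^sub>L ident V id_blinfun) ` B \<and>
    normal_unital_star_endomorphism B \<theta> \<and>
    (\<forall>x\<in>A. \<forall>n. (\<tau> ^^ n) x = compress V ((\<theta> ^^ n) (ident V x))) \<and>
    closure (cspan {dilation_word V \<theta> x n (V h) | x n h. \<forall>i. x i \<in> A}) = UNIV \<and>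
    B = generated_vna {(\<theta> ^^ n) (ident V x) | n x. x \<in> A}"

section \<open>The peripheral Poisson boundary\<close>

definition peripheral_space ::
  "('h::complex_hilbert_space \<Rightarrow>\<^sub>L 'h) set \<Rightarrow> (('h \<Rightarrow>\<^sub>L 'h) \<Rightarrow> 'h \<Rightarrow>\<^sub>L 'h) \<Rightarrow> ('h \<Rightarrow>\<^sub>L 'h) set"
  where "peripheral_space M f =
    closure (cspan {x \<in> M. \<exists>\<alpha>. norm \<alpha> = 1 \<and> f x = \<alpha> *\<^sub>C x})"

text \<open>The product \<open>x \<circ> y = T (T\<^sup>-\<^sup>1 x T\<^sup>-\<^sup>1 y)\<close>, where \<open>T = compress V\<close> restricted to the peripheral
  space of \<open>\<theta>\<close>, a bijection onto the peripheral space of \<open>\<tau>\<close>.\<close>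

definition peripheral_product ::
  "('h::complex_hilbert_space \<Rightarrow>\<^sub>L 'k::complex_hilbert_space) \<Rightarrow> ('k \<Rightarrow>\<^sub>L 'k) set \<Rightarrow>
    (('k \<Rightarrow>\<^sub>L 'k) \<Rightarrow> 'k \<Rightarrow>\<^sub>L 'k) \<Rightarrow> ('h \<Rightarrow>\<^sub>L 'h) \<Rightarrow> ('h \<Rightarrow>\<^sub>L 'h) \<Rightarrow> 'h \<Rightarrow>\<^sub>L 'h"
  where "peripheral_product V B \<theta> x y =
    (let T_inv = the_inv_into (peripheral_space B \<theta>) (compress V)
     in compress V (T_inv x o\<^sub>L T_inv y))"

end

theory Submission
  imports Defs
begin

text \<open>Write \<open>p\<close> for the projection of \<open>\<K>\<close> onto \<open>\<H>\<close> and \<open>p\<^sub>n = \<theta>\<^sup>n(p)\<close>. Since \<open>\<tau>\<close> is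
  unital, the \<open>p\<^sub>n\<close> increase, and minimality says that they increase to the identity
  (\<open>P_tendsto\<close>). Hence an operator on \<open>\<K>\<close> is determined by its corners \<open>p\<^sub>n z p\<^sub>n\<close>.

  Let \<open>\<tau> x = \<alpha> x\<close> with \<open>\<bar>\<alpha>\<bar> = 1\<close> and put \<open>X\<^sub>n = \<alpha>\<^sup>-\<^sup>n \<theta>\<^sup>n(x)\<close>. The dilation property turns the
  eigenvalue equation into \<open>p\<^sub>m X\<^sub>n p\<^sub>m = X\<^sub>m\<close> for \<open>m \<le> n\<close>: the \<open>X\<^sub>n\<close> are a bounded
  operator-valued martingale, so they converge strongly (\<open>operator_martingale_converges\<close>). The
  limit \<open>z\<close> has the corners \<open>X\<^sub>n\<close>; in particular its compression is \<open>x\<close>, and a comparison of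
  corners gives \<open>\<theta> z = \<alpha> z\<close> (\<open>eigenvector_lift\<close>). So \<open>z\<close> is a preimage of \<open>x\<close> under the
  compression \<open>T\<close>.

  It is the only one in the peripheral space of \<open>\<theta>\<close>, because \<open>T\<close> is isometric there
  (\<open>norm_le_compress\<close>): for a linear combination \<open>z\<close> of eigenvectors there are \<open>n\<^sub>k \<rightarrow> \<infinity>\<close> along
  which \<open>\<theta>\<^sup>n(z) \<rightarrow> z\<close> in norm, so that \<open>\<theta>\<^sup>n(pzp) = p\<^sub>n \<theta>\<^sup>n(z) p\<^sub>n\<close> converges strongly to \<open>z\<close> along
  the \<open>n\<^sub>k\<close>, while its norm never exceeds that of \<open>pzp\<close>.

  Therefore, with the corresponding sequence \<open>Y\<^sub>n\<close> for \<open>y\<close>, the peripheral product is the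
  compression of the strong limit of \<open>X\<^sub>n Y\<^sub>n\<close>; and the compression of \<open>X\<^sub>n Y\<^sub>n\<close> is
  \<open>(\<alpha>\<mu>)\<^sup>-\<^sup>n \<tau>\<^sup>n(xy)\<close>.

  Finally let \<open>\<phi>\<close> be a faithful invariant state. The defect \<open>\<tau>(y\<^sup>*y) - y\<^sup>*y\<close> is \<open>c\<^sup>*c\<close>, where \<open>c\<close>
  is the corner of \<open>\<theta>(y)\<close> mapping \<open>\<H>\<close> into its orthogonal complement, and \<open>\<phi>\<close> vanishes on it. So
  \<open>c = 0\<close>, which makes \<open>y\<close> multiplicative for \<open>\<tau>\<close>; then \<open>\<tau>(xy) = \<alpha>\<mu> xy\<close> and the sequence of
  the limit formula is constant (\<open>tau_pow_compose_faithful\<close>).\<close>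

section \<open>Inner products and adjoints\<close>

lemma scaleC_one [simp]: "1 *\<^sub>C (x :: 'a::complex_vector) = x"
  using scaleC_of_real [of 1 x] by simp

lemma scaleC_minus_one [simp]: "(- 1) *\<^sub>C (x :: 'a::complex_vector) = - x"
  using scaleC_of_real [of "-1" x] by simp

lemma scaleC_zero_left [simp]: "0 *\<^sub>C (x :: 'a::complex_vector) = 0"
  using scaleC_of_real [of 0 x] by simp

lemma scaleC_zero_right [simp]: "c *\<^sub>C (0 :: 'a::complex_vector) = 0"
  using scaleC_add_right [of c 0 "0 :: 'a"] by simp

lemma scaleC_diff_right: "c *\<^sub>C (x - y) = c *\<^sub>C x - c *\<^sub>C (y :: 'a::complex_vector)"
  using scaleC_add_right [of c "x - y" y] by (simp add: algebra_simps)

lemma cinner_add_left: "cinner (x + y) z = cinner x z + cinner y z"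
  by (metis cinner_add_right cinner_commute complex_cnj_add)

lemma cinner_scaleC_left: "cinner (c *\<^sub>C x) y = cnj c * cinner x y"
  by (metis cinner_scaleC_right cinner_commute complex_cnj_mult)

lemma cinner_zero_right [simp]: "cinner x 0 = 0"
  using cinner_add_right [of x 0 0] by simp

lemma cinner_zero_left [simp]: "cinner 0 x = 0"
  using cinner_add_left [of 0 0 x] by simp

lemma cinner_diff_right: "cinner x (y - z) = cinner x y - cinner x z"
  using cinner_add_right [of x "y - z" z] by simp

lemma cinner_diff_left: "cinner (x - y) z = cinner x z - cinner y z"
  using cinner_add_left [of "x - y" y z] by simp

lemma norm_add_sq: "(norm (x + y))\<^sup>2 = (norm x)\<^sup>2 + (norm y)\<^sup>2 + 2 * Re (cinner x y)"
proof -
  have "complex_of_real ((norm (x + y))\<^sup>2) = cinner (x + y) (x + y)"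
    by (rule cinner_self [symmetric])
  also have "\<dots> = cinner x x + cinner y y + (cinner x y + cnj (cinner x y))"
    by (simp add: cinner_add_left cinner_add_right cinner_commute [of y x])
  finally show ?thesis
    by (auto simp add: cinner_self complex_add_cnj complex_eq_iff)
qed

lemma norm_diff_sq: "(norm (x - y))\<^sup>2 = (norm x)\<^sup>2 + (norm y)\<^sup>2 - 2 * Re (cinner x y)"
proof -
  have "Re (cinner x (- y)) = - Re (cinner x y)"
    using cinner_diff_right [of x 0 y] by simp
  then show ?thesis
    using norm_add_sq [of x "- y"] by simp
qed

lemma Re_cinner_le: "Re (cinner x y) \<le> norm x * norm y"
proof -
  have "(norm (x + y))\<^sup>2 \<le> (norm x + norm y)\<^sup>2"
    by (simp add: norm_triangle_ineq power_mono)
  then show ?thesis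
    by (simp add: norm_add_sq power2_sum)
qed

lemma cinner_right_eqI:
  assumes "\<And>x. cinner x y = cinner x z"
  shows "y = z"
proof -
  have "cinner (y - z) (y - z) = 0"
    using assms by (simp add: cinner_diff_right)
  then show ?thesis
    by (simp add: cinner_self)
qed

lemma nonneg_quadratic_imp_linear_zero:
  fixes a b :: real
  assumes nonneg: "\<And>t. 0 \<le> t\<^sup>2 * a + 2 * t * b"
  shows "b = 0"
proof -
  have "0 \<le> a"
    using nonneg [of 1] nonneg [of "- 1"] by simp
  have "0 \<le> (a + 1)\<^sup>2 * ((- b / (a + 1))\<^sup>2 * a + 2 * (- b / (a + 1)) * b)"
    by (intro mult_nonneg_nonneg nonneg) simp
  also have "\<dots> = - (b\<^sup>2 * (a + 2))"
    using \<open>0 \<le> a\<close> by (simp add: divide_simps) (simp add: power2_eq_square algebra_simps)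
  finally have "b\<^sup>2 * (a + 2) \<le> 0" by simp
  with \<open>0 \<le> a\<close> show ?thesis
    by (simp add: mult_le_0_iff)
qed

text \<open>Minimise \<open>J x = \<parallel>x\<parallel>\<^sup>2 - 2 Re (f x)\<close>. By the parallelogram law every minimising
  sequence is Cauchy, and the vanishing of the first variation of \<open>J\<close> at its limit is the claim.\<close>

lemma Riesz_representation:
  fixes f :: "'a::complex_hilbert_space \<Rightarrow> complex"
  assumes lin: "bounded_linear f" and hom: "\<And>c x. f (c *\<^sub>C x) = c * f x"
  shows "\<exists>u. \<forall>x. f x = cinner u x"
proof -
  interpret bounded_linear f by (rule lin)
  define J where "J x = (norm x)\<^sup>2 - 2 * Re (f x)" for x
  define m where "m = Inf (range J)"
  have "bdd_below (range J)"
  proof -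
    obtain K where K: "norm (f x) \<le> norm x * K" for x
      using bounded by blast
    have "- K\<^sup>2 \<le> J x" for x
    proof -
      have "Re (f x) \<le> norm x * K"
        using complex_Re_le_cmod [of "f x"] K [of x] by linarith
      moreover have "0 \<le> (norm x - K)\<^sup>2" by simp
      ultimately show ?thesis
        by (simp add: J_def power2_diff algebra_simps)
    qed
    then show ?thesis by (intro bdd_belowI) auto
  qed
  then have m_le: "m \<le> J x" for x
    unfolding m_def by (simp add: cInf_lower)
  have "\<exists>x. J x < m + inverse (Suc n)" for n
  proof -
    have "Inf (range J) < m + inverse (Suc n)"
      by (simp add: m_def)
    then show ?thesis
      using cInf_lessD [of "range J"] by blast
  qed
  then obtain s where s: "J (s n) < m + inverse (Suc n)" for n
    by metis
  have parallelogram: "(norm (x - y))\<^sup>2 \<le> 2 * (J x - m) + 2 * (J y - m)" for x y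
  proof -
    define h where "h = (1/2) *\<^sub>R (x + y)"
    have norm_h: "(norm h)\<^sup>2 = (norm (x + y))\<^sup>2 / 4"
      unfolding h_def norm_scaleR by (simp add: power_mult_distrib power_divide)
    have f_h: "f h = (1/2) *\<^sub>R (f x + f y)"
      unfolding h_def by (simp only: scaleR add)
    have "J h = (norm (x + y))\<^sup>2 / 4 - (Re (f x) + Re (f y))"
      unfolding J_def norm_h f_h by (simp add: field_simps)
    with m_le [of h] show ?thesis
      by (simp add: J_def [of x] J_def [of y] norm_add_sq norm_diff_sq field_simps)
  qed
  have "Cauchy s"
  proof (rule metric_CauchyI)
    fix e :: real
    assume "0 < e"
    then obtain N where N: "inverse (Suc N) < e\<^sup>2 / 4"
      using reals_Archimedean [of "e\<^sup>2 / 4"] by auto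
    have near: "J (s i) - m < e\<^sup>2 / 4" if "i \<ge> N" for i
    proof -
      have "inverse (real (Suc i)) \<le> inverse (real (Suc N))"
        using that by (simp add: le_imp_inverse_le)
      then show ?thesis
        using s [of i] N by argo
    qed
    have "dist (s i) (s j) < e" if "i \<ge> N" "j \<ge> N" for i j
    proof -
      have "(norm (s i - s j))\<^sup>2 < e\<^sup>2"
        using parallelogram [of "s i" "s j"] near [OF that(1)] near [OF that(2)] by argo
      then show ?thesis
        using \<open>0 < e\<close> by (simp add: dist_norm power2_less_imp_less)
    qed
    then show "\<exists>M. \<forall>i\<ge>M. \<forall>j\<ge>M. dist (s i) (s j) < e" by blast
  qed
  then obtain u where u: "s \<longlonglongrightarrow> u"
    using Cauchy_convergent convergent_def by blast
  have "(\<lambda>n. J (s n)) \<longlonglongrightarrow> J u"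
    unfolding J_def by (intro tendsto_intros tendsto u)
  moreover have "(\<lambda>n. m + inverse (real (Suc n))) \<longlonglongrightarrow> m"
    using tendsto_add [OF tendsto_const LIMSEQ_inverse_real_of_nat] by simp
  ultimately have "J u \<le> m"
    by (rule LIMSEQ_le) (use s less_imp_le in blast)
  \<comment> \<open>The first variation of \<open>J\<close> at the minimum \<open>u\<close> vanishes.\<close>
  have Re_eq: "Re (f v) = Re (cinner u v)" for v
  proof -
    have "0 \<le> t\<^sup>2 * (norm v)\<^sup>2 + 2 * t * (Re (cinner u v) - Re (f v))" for t
    proof -
      have "J (u + t *\<^sub>R v) = J u + t\<^sup>2 * (norm v)\<^sup>2 + 2 * t * (Re (cinner u v) - Re (f v))"
      proof -
        have "cinner u (t *\<^sub>R v) = complex_of_real t * cinner u v"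
          by (simp add: scaleC_of_real [symmetric] cinner_scaleC_right)
        then show ?thesis
          by (simp add: J_def norm_add_sq add scaleR power_mult_distrib algebra_simps)
      qed
      then show ?thesis
        using m_le [of "u + t *\<^sub>R v"] \<open>J u \<le> m\<close> by linarith
    qed
    then show ?thesis
      using nonneg_quadratic_imp_linear_zero by fastforce
  qed
  have "f v = cinner u v" for v
    using Re_eq [of v] Re_eq [of "\<i> *\<^sub>C v"]
    by (simp add: hom cinner_scaleC_right complex_eq_iff)
  then show ?thesis by blast
qed

lemma bounded_opsD: "a \<in> bounded_ops \<Longrightarrow> blinfun_apply a (c *\<^sub>C x) = c *\<^sub>C blinfun_apply a x"
  by (simp add: bounded_ops_def)

lemma bounded_ops_id [simp]: "id_blinfun \<in> bounded_ops"
  by (simp add: bounded_ops_def)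

lemma bounded_ops_compose [simp]:
  "a \<in> bounded_ops \<Longrightarrow> b \<in> bounded_ops \<Longrightarrow> a o\<^sub>L b \<in> bounded_ops"
  by (simp add: bounded_ops_def)

lemma bounded_ops_diff [simp]:
  "a \<in> bounded_ops \<Longrightarrow> b \<in> bounded_ops \<Longrightarrow> a - b \<in> bounded_ops"
  by (simp add: bounded_ops_def blinfun.diff_left scaleC_diff_right)

lemma bounded_ops_scaleC [simp]: "a \<in> bounded_ops \<Longrightarrow> c *\<^sub>C a \<in> bounded_ops"
  by (simp add: bounded_ops_def scaleC_blinfun.rep_eq scaleC_scaleC mult.commute)

lemma bounded_ops_zero [simp]: "0 \<in> bounded_ops"
  by (simp add: bounded_ops_def)

lemma compose_scaleC_left: "(c *\<^sub>C a) o\<^sub>L b = c *\<^sub>C (a o\<^sub>L b)"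
  by (rule blinfun_eqI) (simp add: scaleC_blinfun.rep_eq)

lemma compose_scaleC_right: "a \<in> bounded_ops \<Longrightarrow> a o\<^sub>L (c *\<^sub>C b) = c *\<^sub>C (a o\<^sub>L b)"
  by (rule blinfun_eqI) (simp add: scaleC_blinfun.rep_eq bounded_opsD)

lemma compose_id [simp]: "id_blinfun o\<^sub>L a = a" "a o\<^sub>L id_blinfun = a"
  by (simp_all add: blinfun_eqI)

lemma compose_assoc: "(a o\<^sub>L b) o\<^sub>L c = a o\<^sub>L (b o\<^sub>L c)"
  by (rule blinfun_eqI) simp

lemma cadj_unique:
  assumes "\<And>x y. cinner (blinfun_apply a x) y = cinner x (blinfun_apply b y)"
  shows "cadj a = b"
  unfolding cadj_def
proof (rule the_equality)
  fix c
  assume "\<forall>x y. cinner (blinfun_apply a x) y = cinner x (blinfun_apply c y)"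
  then show "c = b"
    using assms by (metis blinfun_eqI cinner_right_eqI)
qed (use assms in blast)

lemma adjoint_exists:
  fixes a :: "'h::complex_hilbert_space \<Rightarrow>\<^sub>L 'k::complex_hilbert_space"
  assumes a: "a \<in> bounded_ops"
  shows "\<exists>b. \<forall>x y. cinner (blinfun_apply a x) y = cinner x (blinfun_apply b y)"
proof -
  have "\<exists>u. \<forall>x. cinner y (blinfun_apply a x) = cinner u x" for y
  proof (rule Riesz_representation)
    \<comment> \<open>Replacing \<open>x\<close> by \<open>cnj c\<close> times \<open>x\<close> turns the inner product \<open>c\<close> into \<open>\<bar>c\<bar>\<^sup>2\<close>.\<close>
    have le: "norm (cinner y (blinfun_apply a x)) \<le> norm x * (norm y * norm a)" for x
    proof -
      define c where "c = cinner y (blinfun_apply a x)"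
      have "(norm c)\<^sup>2 = Re (cinner y (blinfun_apply a (cnj c *\<^sub>C x)))"
        by (simp add: bounded_opsD [OF a] cinner_scaleC_right c_def [symmetric]
            cmod_power2) (simp add: power2_eq_square)
      also have "\<dots> \<le> norm y * norm (blinfun_apply a (cnj c *\<^sub>C x))"
        by (rule Re_cinner_le)
      also have "\<dots> \<le> norm y * (norm a * (norm c * norm x))"
        using norm_blinfun [of a "cnj c *\<^sub>C x"]
        by (intro mult_left_mono) (simp_all add: norm_scaleC)
      finally have "norm c * norm c \<le> norm c * (norm x * (norm y * norm a))"
        by (simp add: power2_eq_square algebra_simps)
      then show ?thesis
        unfolding c_def [symmetric]
        by (cases "norm c = 0") (auto simp: mult_le_cancel_left)
    qed
    show "bounded_linear (\<lambda>x. cinner y (blinfun_apply a x))"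
    proof (rule bounded_linear_intro)
      show "cinner y (blinfun_apply a (r *\<^sub>R x)) = r *\<^sub>R cinner y (blinfun_apply a x)" for r x
        by (simp add: scaleC_of_real [symmetric] bounded_opsD [OF a] cinner_scaleC_right
            scaleC_complex_def)
    qed (use le in \<open>simp_all add: blinfun.add_right cinner_add_right\<close>)
    show "cinner y (blinfun_apply a (c *\<^sub>C x)) = c * cinner y (blinfun_apply a x)" for c x
      by (simp add: bounded_opsD [OF a] cinner_scaleC_right)
  qed
  then obtain g where "cinner y (blinfun_apply a x) = cinner (g y) x" for x y
    by metis
  then have g: "cinner (blinfun_apply a x) y = cinner x (g y)" for x y
    by (metis cinner_commute)
  have "bounded_linear g"
  proof (rule bounded_linear_intro)
    show "g (y + z) = g y + g z" for y z
      by (rule cinner_right_eqI) (simp add: g [symmetric] cinner_add_right)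
    show "g (r *\<^sub>R y) = r *\<^sub>R g y" for r y
      by (rule cinner_right_eqI)
        (simp add: g [symmetric] cinner_scaleC_right scaleC_of_real [symmetric])
    show "norm (g y) \<le> norm y * norm a" for y
    proof -
      have "(norm (g y))\<^sup>2 = Re (cinner (blinfun_apply a (g y)) y)"
        by (simp add: g cinner_self)
      also have "\<dots> \<le> norm (blinfun_apply a (g y)) * norm y"
        by (rule Re_cinner_le)
      also have "\<dots> \<le> (norm a * norm (g y)) * norm y"
        by (intro mult_right_mono norm_blinfun) simp
      finally have "norm (g y) * norm (g y) \<le> norm (g y) * (norm y * norm a)"
        by (simp add: power2_eq_square algebra_simps)
      then show ?thesis
        by (cases "norm (g y) = 0") (auto simp: mult_le_cancel_left)
    qed
  qed
  then show ?thesis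
    using g bounded_linear_Blinfun_apply by metis
qed

lemma cinner_cadj:
  "a \<in> bounded_ops \<Longrightarrow> cinner (blinfun_apply a x) y = cinner x (blinfun_apply (cadj a) y)"
  using adjoint_exists cadj_unique by metis

lemma cinner_cadj_left:
  "a \<in> bounded_ops \<Longrightarrow> cinner (blinfun_apply (cadj a) x) y = cinner x (blinfun_apply a y)"
  by (metis cinner_cadj cinner_commute)

lemma bounded_ops_cadj [simp]:
  assumes "a \<in> bounded_ops"
  shows "cadj a \<in> bounded_ops"
  unfolding bounded_ops_def
proof (safe, rule cinner_right_eqI)
  fix c x y
  show "cinner y (blinfun_apply (cadj a) (c *\<^sub>C x)) = cinner y (c *\<^sub>C blinfun_apply (cadj a) x)"
    by (simp add: cinner_cadj [OF assms, symmetric] cinner_scaleC_right)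
qed

lemma cadj_compose:
  "a \<in> bounded_ops \<Longrightarrow> b \<in> bounded_ops \<Longrightarrow> cadj (a o\<^sub>L b) = cadj b o\<^sub>L cadj a"
  by (rule cadj_unique) (simp add: cinner_cadj)

lemma cadj_cadj [simp]: "a \<in> bounded_ops \<Longrightarrow> cadj (cadj a) = a"
  by (rule cadj_unique) (simp add: cinner_cadj_left)

lemma cadj_id [simp]: "cadj id_blinfun = id_blinfun"
  by (rule cadj_unique) simp

lemma cadj_scaleC: "a \<in> bounded_ops \<Longrightarrow> cadj (c *\<^sub>C a) = cnj c *\<^sub>C cadj a"
  by (rule cadj_unique)
    (simp add: scaleC_blinfun.rep_eq cinner_scaleC_left cinner_scaleC_right cinner_cadj)

lemma norm_apply_sq:
  assumes "a \<in> bounded_ops"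
  shows "complex_of_real ((norm (blinfun_apply a x))\<^sup>2) = cinner x (blinfun_apply (cadj a o\<^sub>L a) x)"
  by (simp add: cinner_self [symmetric] cinner_cadj [OF assms] del: of_real_power)

lemma positive_op_cadj_compose: "a \<in> bounded_ops \<Longrightarrow> positive_op (cadj a o\<^sub>L a)"
  unfolding positive_op_def by (auto simp: norm_apply_sq [symmetric] simp del: blinfun_apply_blinfun_compose)

lemma cadj_compose_eq_zero:
  assumes "a \<in> bounded_ops" "cadj a o\<^sub>L a = 0"
  shows "a = 0"
proof (rule blinfun_eqI)
  show "blinfun_apply a x = blinfun_apply 0 x" for x
    using norm_apply_sq [OF assms(1), of x] assms(2) by simp
qed

section \<open>Projections and the strong operator topology\<close>

lemma limitin_strong_operator_topologyI:
  assumes "\<And>v. ((\<lambda>n. blinfun_apply (f n) v) \<longlongrightarrow> blinfun_apply l v) F"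
  shows "limitin strong_operator_topology f l F"
  unfolding limitin_def
proof (intro conjI allI impI)
  fix U
  assume U: "openin strong_operator_topology U \<and> l \<in> U"
  then obtain W where W: "open W" "U = blinfun_apply -` W"
    unfolding strong_operator_topology_def by (auto simp: openin_pullback_topology)
  have "((\<lambda>n. blinfun_apply (f n)) \<longlongrightarrow> blinfun_apply l) F"
    using assms
    by (simp flip: limitin_canonical_iff add: euclidean_product_topology [symmetric] limitin_componentwise)
  then show "\<forall>\<^sub>F n in F. f n \<in> U"
    using U W topological_tendstoD by fastforce
qed (simp add: strong_operator_topology_topspace)

lemma tendsto_blinfun_apply_strong:
  fixes a :: "nat \<Rightarrow> 'a::real_normed_vector \<Rightarrow>\<^sub>L 'b::real_normed_vector"
  assumes strong: "\<And>v. (\<lambda>n. blinfun_apply (a n) v) \<longlonglongrightarrow> blinfun_apply l v"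
    and bound: "\<And>n. norm (a n) \<le> K"
    and w: "w \<longlonglongrightarrow> v"
  shows "(\<lambda>n. blinfun_apply (a n) (w n)) \<longlonglongrightarrow> blinfun_apply l v"
proof -
  have "(\<lambda>n. K * norm (w n - v)) \<longlonglongrightarrow> K * norm (v - v)"
    by (intro tendsto_intros w)
  then have "(\<lambda>n. K * norm (w n - v)) \<longlonglongrightarrow> 0" by simp
  moreover have "\<forall>n. norm (blinfun_apply (a n) (w n - v)) \<le> K * norm (w n - v)"
    using norm_blinfun bound by (meson mult_right_mono norm_ge_zero order_trans)
  ultimately have "(\<lambda>n. blinfun_apply (a n) (w n - v)) \<longlonglongrightarrow> 0"
    by (rule Lim_null_comparison [OF always_eventually, rotated])
  from tendsto_add [OF this strong [of v]] show ?thesis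
    by (simp add: blinfun.diff_right)
qed

definition projection_op :: "('h::complex_hilbert_space \<Rightarrow>\<^sub>L 'h) \<Rightarrow> bool"
  where "projection_op q \<longleftrightarrow> q \<in> bounded_ops \<and> cadj q = q \<and> q o\<^sub>L q = q"

lemma projection_op_apply_idem: "projection_op q \<Longrightarrow> blinfun_apply q (blinfun_apply q v) = blinfun_apply q v"
  by (metis projection_op_def blinfun_apply_blinfun_compose)

lemma projection_op_cinner:
  "projection_op q \<Longrightarrow> cinner (blinfun_apply q v) w = cinner v (blinfun_apply q w)"
  by (metis projection_op_def cinner_cadj)

lemma projection_op_norm_diff_sq:
  assumes "projection_op q"
  shows "(norm (v - blinfun_apply q v))\<^sup>2 = (norm v)\<^sup>2 - (norm (blinfun_apply q v))\<^sup>2"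
proof -
  have "cinner v (blinfun_apply q v) = complex_of_real ((norm (blinfun_apply q v))\<^sup>2)"
    by (metis assms cinner_self projection_op_apply_idem projection_op_cinner)
  then show ?thesis
    by (simp add: norm_diff_sq)
qed

lemma projection_op_norm_le: 
  assumes "projection_op q"
  shows "norm (blinfun_apply q v) \<le> norm v"
  using projection_op_norm_diff_sq [OF assms, of v] 
  by (metis diff_ge_0_iff_ge norm_ge_zero power2_le_imp_le zero_le_power2)

text \<open>For \<open>v\<close> in the range of \<open>P\<^sub>m\<close> the sequence \<open>X\<^sub>n v\<close> is a martingale with respect to the
  ranges of the \<open>P\<^sub>n\<close>, so its increments are orthogonal. Its squared norms therefore increase, and
  being bounded they make it Cauchy. These ranges are dense and the \<open>X\<^sub>n\<close> are uniformly bounded,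
  so convergence extends to all \<open>v\<close>.\<close>

lemma operator_martingale_converges:
  fixes P X :: "nat \<Rightarrow> 'k::complex_hilbert_space \<Rightarrow>\<^sub>L 'k"
  assumes proj: "\<And>n. projection_op (P n)"
    and incr: "\<And>m n. m \<le> n \<Longrightarrow> P n o\<^sub>L P m = P m"
    and dense: "\<And>v. (\<lambda>n. blinfun_apply (P n) v) \<longlonglongrightarrow> v"
    and X: "\<And>n. X n \<in> bounded_ops"
    and bound: "\<And>n. norm (X n) \<le> K"
    and martingale: "\<And>m n. m \<le> n \<Longrightarrow> P m o\<^sub>L X n o\<^sub>L P m = X m"
  shows "\<exists>Z\<in>bounded_ops. \<forall>v. (\<lambda>n. blinfun_apply (X n) v) \<longlonglongrightarrow> blinfun_apply Z v"
proof -
  have Pm: "P n (P m v) = P m v" if "m \<le> n" for m n v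
    using incr [OF that] by (metis blinfun_apply_blinfun_compose)
  have mart: "P m (X n (P m v)) = X m v" if "m \<le> n" for m n v
    using martingale [OF that] by (metis blinfun_apply_blinfun_compose)
  have Cauchy_range: "Cauchy (\<lambda>n. X n (P m v))" for m v
  proof -
    define y where "y n = X n (P m v)" for n
    have orth: "(norm (y k - y n))\<^sup>2 = (norm (y k))\<^sup>2 - (norm (y n))\<^sup>2" if "m \<le> n" "n \<le> k" for n k
    proof -
      have "P n (y k) = y n"
        using mart [OF \<open>n \<le> k\<close>, of "P m v"] Pm [OF \<open>m \<le> n\<close>] by (simp add: y_def)
      then show ?thesis
        using projection_op_norm_diff_sq [OF proj [of n], of "y k"] by simp
    qed
    define f where "f n = (norm (y (n + m)))\<^sup>2" for n
    have "incseq f"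
    proof (rule incseq_SucI)
      show "f n \<le> f (Suc n)" for n
        using orth [of "n + m" "Suc n + m"] zero_le_power2 [of "norm (y (Suc n + m) - y (n + m))"]
        by (simp add: f_def)
    qed
    moreover have "f n \<le> (K * norm (P m v))\<^sup>2" for n
    proof -
      have "norm (y (n + m)) \<le> norm (X (n + m)) * norm (P m v)"
        unfolding y_def by (rule norm_blinfun)
      also have "\<dots> \<le> K * norm (P m v)"
        by (intro mult_right_mono bound) simp
      finally show ?thesis
        by (simp add: f_def power_mono)
    qed
    ultimately have "convergent f"
      using incseq_convergent convergentI by metis
    then have "Cauchy f" by (rule convergent_Cauchy)
    have "Cauchy (\<lambda>n. y (n + m))"
    proof (rule metric_CauchyI)
      fix e :: real
      assume "0 < e"
      then obtain N where N: "\<And>i j. i \<ge> N \<Longrightarrow> j \<ge> N \<Longrightarrow> dist (f i) (f j) < e\<^sup>2"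
        using metric_CauchyD [OF \<open>Cauchy f\<close>, of "e\<^sup>2"] by (metis zero_less_power)
      have less: "dist (y (i + m)) (y (j + m)) < e" if "i \<ge> N" "j \<ge> N" "j \<le> i" for i j
      proof -
        have "(norm (y (i + m) - y (j + m)))\<^sup>2 = f i - f j"
          using that orth [of "j + m" "i + m"] by (simp add: f_def)
        then have "(norm (y (i + m) - y (j + m)))\<^sup>2 < e\<^sup>2"
          using N [OF that(1,2)] by (simp add: dist_real_def)
        then show ?thesis
          using \<open>0 < e\<close> by (simp add: dist_norm power2_less_imp_less)
      qed
      show "\<exists>M. \<forall>i\<ge>M. \<forall>j\<ge>M. dist (y (i + m)) (y (j + m)) < e"
        using less by (metis dist_commute nat_le_linear)
    qed
    then have "Cauchy y"
      by (metis Cauchy_convergent convergent_Cauchy convergent_ignore_initial_segment)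
    then show ?thesis
      by (simp add: y_def [abs_def])
  qed
  have "Cauchy (\<lambda>n. X n v)" for v
  proof (rule metric_CauchyI)
    fix e :: real
    assume "0 < e"
    have "0 \<le> K"
      using bound [of 0] norm_ge_zero order_trans by blast
    have "(\<lambda>n. K * norm (P n v - v)) \<longlonglongrightarrow> K * norm (v - v)"
      by (intro tendsto_intros dense)
    then have "\<forall>\<^sub>F n in sequentially. K * norm (P n v - v) < e / 3"
      using \<open>0 < e\<close> by (intro order_tendstoD) auto
    then obtain m where m: "K * norm (P m v - v) < e / 3"
      by (meson eventually_happens trivial_limit_sequentially)
    obtain N where N: "\<And>i j. i \<ge> N \<Longrightarrow> j \<ge> N \<Longrightarrow> dist (X i (P m v)) (X j (P m v)) < e / 3"
      using metric_CauchyD [OF Cauchy_range [of m v], of "e / 3"] \<open>0 < e\<close> by auto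
    have near: "dist (X i v) (X i (P m v)) < e / 3" for i
    proof -
      have "norm (X i (P m v - v)) \<le> norm (X i) * norm (P m v - v)"
        by (rule norm_blinfun)
      also have "\<dots> \<le> K * norm (P m v - v)"
        by (intro mult_right_mono bound) simp
      finally show ?thesis
        using m by (simp add: dist_norm norm_minus_commute blinfun.diff_right)
    qed
    have "dist (X i v) (X j v) < e" if "i \<ge> N" "j \<ge> N" for i j
      using near [of i] near [of j] N [OF that]
        dist_triangle [of "X i v" "X j v" "X i (P m v)"]
        dist_triangle2 [of "X i (P m v)" "X j v" "X j (P m v)"]
      by linarith
    then show "\<exists>M. \<forall>i\<ge>M. \<forall>j\<ge>M. dist (X i v) (X j v) < e" by blast
  qed
  then have "\<exists>l. (\<lambda>n. X n v) \<longlonglongrightarrow> l" for v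
    using Cauchy_convergent convergent_def by blast
  then obtain g where g: "(\<lambda>n. X n v) \<longlonglongrightarrow> g v" for v
    by metis
  have "bounded_linear g"
  proof (rule bounded_linear_intro)
    show "g (v + w) = g v + g w" for v w
      using LIMSEQ_unique [OF g [of "v + w"]] tendsto_add [OF g [of v] g [of w]]
      by (simp add: blinfun.add_right)
    show "g (r *\<^sub>R v) = r *\<^sub>R g v" for r v
      using LIMSEQ_unique [OF g [of "r *\<^sub>R v"]] tendsto_scaleR [OF tendsto_const g [of v]]
      by (simp add: blinfun.scaleR_right)
    show "norm (g v) \<le> norm v * K" for v
    proof (rule LIMSEQ_le_const2 [OF tendsto_norm [OF g]], intro exI allI impI)
      show "norm (X n v) \<le> norm v * K" for n
        using norm_blinfun [of "X n" v] mult_right_mono [OF bound [of n], of "norm v"]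
        by (simp add: mult.commute)
    qed
  qed
  then have apply_g: "blinfun_apply (Blinfun g) = g"
    by (rule bounded_linear_Blinfun_apply)
  have "g (c *\<^sub>C v) = c *\<^sub>C g v" for c v
  proof -
    have "(\<lambda>n. c *\<^sub>C X n v) \<longlonglongrightarrow> c *\<^sub>C g v"
      by (rule bounded_linear.tendsto [OF bounded_linear_scaleC_right g])
    then show ?thesis
      using LIMSEQ_unique [OF g [of "c *\<^sub>C v"]] by (simp add: bounded_opsD [OF X])
  qed
  then have "Blinfun g \<in> bounded_ops"
    by (simp add: bounded_ops_def apply_g)
  then show ?thesis
    using g apply_g by metis
qed

section \<open>Endomorphisms of von Neumann algebras\<close>

lemma vna_bounded_ops: "von_neumann_algebra M \<Longrightarrow> a \<in> M \<Longrightarrow> a \<in> bounded_ops"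
  unfolding von_neumann_algebra_def by blast

lemma vna_id: "von_neumann_algebra M \<Longrightarrow> id_blinfun \<in> M"
  unfolding von_neumann_algebra_def by blast

lemma vna_add: "von_neumann_algebra M \<Longrightarrow> a \<in> M \<Longrightarrow> b \<in> M \<Longrightarrow> a + b \<in> M"
  unfolding von_neumann_algebra_def by blast

lemma vna_scaleC: "von_neumann_algebra M \<Longrightarrow> a \<in> M \<Longrightarrow> c *\<^sub>C a \<in> M"
  unfolding von_neumann_algebra_def by blast

lemma vna_compose: "von_neumann_algebra M \<Longrightarrow> a \<in> M \<Longrightarrow> b \<in> M \<Longrightarrow> a o\<^sub>L b \<in> M"
  unfolding von_neumann_algebra_def by blast

lemma vna_cadj: "von_neumann_algebra M \<Longrightarrow> a \<in> M \<Longrightarrow> cadj a \<in> M"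
  unfolding von_neumann_algebra_def by blast

lemma vna_diff: "von_neumann_algebra M \<Longrightarrow> a \<in> M \<Longrightarrow> b \<in> M \<Longrightarrow> a - b \<in> M"
  using vna_add [of M a "(-1) *\<^sub>C b"] vna_scaleC [of M b "-1"] by simp

lemma vna_strong_limit:
  assumes M: "von_neumann_algebra M" and a: "\<And>n. a n \<in> M"
    and lim: "\<And>v. (\<lambda>n. blinfun_apply (a n) v) \<longlonglongrightarrow> blinfun_apply z v"
  shows "z \<in> M"
proof (rule limitin_closedin)
  show "limitin strong_operator_topology a z sequentially"
    using lim by (rule limitin_strong_operator_topologyI)
  show "closedin strong_operator_topology M"
    using M by (simp add: von_neumann_algebra_def)
qed (use a in auto)

text \<open>If \<open>a \<le> b\<close>, then \<open>{a, b}\<close> is a directed set with supremum \<open>b\<close>, so \<open>f b\<close> is the supremum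
  of \<open>{f a, f b}\<close>.\<close>

lemma normal_map_mono:
  assumes f: "normal_map M f" and "a \<in> M" "b \<in> M" "cadj a = a" "cadj b = b" "op_le a b"
  shows "op_le (f a) (f b)"
proof -
  have refl: "op_le c c" for c :: "'a \<Rightarrow>\<^sub>L 'a"
    by (simp add: op_le_def positive_op_def)
  have "is_sup_in M {a, b} b"
    using assms refl by (auto simp: is_sup_in_def)
  moreover have "\<forall>c\<in>{a, b}. \<forall>d\<in>{a, b}. \<exists>e\<in>{a, b}. op_le c e \<and> op_le d e"
    using assms refl by auto
  ultimately have "is_sup_in M (f ` {a, b}) (f b)"
    using assms(2-5) by (intro f [unfolded normal_map_def, rule_format] conjI) simp_all
  then show ?thesis
    by (simp add: is_sup_in_def)
qed

text \<open>Apply monotonicity to \<open>a\<^sup>*a \<le> \<parallel>a\<parallel>\<^sup>2\<close>: it gives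
  \<open>\<parallel>f a v\<parallel>\<^sup>2 = \<langle>v, f(a\<^sup>*a) v\<rangle> \<le> \<parallel>a\<parallel>\<^sup>2 \<parallel>v\<parallel>\<^sup>2\<close>.\<close>

lemma star_endomorphism_norm_le:
  assumes M: "von_neumann_algebra M" and f: "normal_unital_star_endomorphism M f" and a: "a \<in> M"
  shows "norm (f a) \<le> norm a"
proof (rule norm_blinfun_bound)
  fix v
  define s :: "'a \<Rightarrow>\<^sub>L 'a" where "s = complex_of_real ((norm a)\<^sup>2) *\<^sub>C id_blinfun"
  note ao = vna_bounded_ops [OF M a]
  have fa: "f a \<in> M"
    using f a by (auto simp: normal_unital_star_endomorphism_def)
  have s: "s \<in> M" "cadj s = s" "f s = s"
    using f vna_id [OF M] vna_scaleC [OF M]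
    by (auto simp: s_def cadj_scaleC normal_unital_star_endomorphism_def clinear_on_def)
  have s_apply: "cinner w (s w) = complex_of_real ((norm a * norm w)\<^sup>2)" for w
    by (simp add: s_def scaleC_blinfun.rep_eq cinner_scaleC_right cinner_self power_mult_distrib)
  have "op_le (cadj a o\<^sub>L a) s"
    unfolding op_le_def positive_op_def
  proof (intro conjI allI)
    show "s - (cadj a o\<^sub>L a) \<in> bounded_ops"
      using ao vna_bounded_ops [OF M s(1)] by simp
    fix w
    have "norm (a w) \<le> norm a * norm w"
      by (rule norm_blinfun)
    then have "(norm (a w))\<^sup>2 \<le> (norm a * norm w)\<^sup>2"
      by (simp add: power_mono)
    moreover have "cinner w ((s - (cadj a o\<^sub>L a)) w)
        = complex_of_real ((norm a * norm w)\<^sup>2 - (norm (a w))\<^sup>2)"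
      by (simp only: blinfun.diff_left cinner_diff_right s_apply norm_apply_sq [OF ao, symmetric]
          of_real_diff)
    ultimately show "cinner w ((s - (cadj a o\<^sub>L a)) w) \<in> \<real>\<^sub>\<ge>\<^sub>0"
      by (simp only: nonneg_Reals_of_real_iff diff_ge_0_iff_ge)
  qed
  moreover have "cadj a o\<^sub>L a \<in> M"
    using vna_compose [OF M vna_cadj [OF M a] a] .
  moreover have "cadj (cadj a o\<^sub>L a) = cadj a o\<^sub>L a"
    using ao by (simp add: cadj_compose)
  moreover have "normal_map M f"
    using f unfolding normal_unital_star_endomorphism_def by blast
  ultimately have "op_le (f (cadj a o\<^sub>L a)) (f s)"
    using s normal_map_mono by blast
  moreover have "f (cadj a o\<^sub>L a) = cadj (f a) o\<^sub>L f a"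
    using f a vna_cadj [OF M a] unfolding normal_unital_star_endomorphism_def by metis
  ultimately have "op_le (cadj (f a) o\<^sub>L f a) s"
    using s(3) by metis
  then have "cinner v ((s - (cadj (f a) o\<^sub>L f a)) v) \<in> \<real>\<^sub>\<ge>\<^sub>0"
    by (simp add: op_le_def positive_op_def)
  moreover have "cinner v ((s - (cadj (f a) o\<^sub>L f a)) v)
      = complex_of_real ((norm a * norm v)\<^sup>2 - (norm (f a v))\<^sup>2)"
    by (simp only: blinfun.diff_left cinner_diff_right s_apply
        norm_apply_sq [OF vna_bounded_ops [OF M fa], symmetric] of_real_diff)
  ultimately have "(norm (f a v))\<^sup>2 \<le> (norm a * norm v)\<^sup>2"
    by (simp only: nonneg_Reals_of_real_iff diff_ge_0_iff_ge)
  then show "norm (f a v) \<le> norm a * norm v"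
    by (rule power2_le_imp_le) simp
qed simp

section \<open>Recurrence of finitely many rotations\<close>

lemma unit_powers_converge_along_subsequence:
  assumes "finite F" "\<And>\<alpha>. \<alpha> \<in> F \<Longrightarrow> norm \<alpha> = (1::real)"
  shows "\<exists>r :: nat \<Rightarrow> nat. strict_mono r \<and> (\<forall>\<alpha>\<in>F. \<exists>l. (\<lambda>k. (\<alpha> :: complex) ^ r k) \<longlonglongrightarrow> l)"
  using assms
proof (induction F rule: finite_induct)
  case empty
  show ?case using strict_mono_id by blast
next
  case (insert \<beta> F)
  then obtain r :: "nat \<Rightarrow> nat" where r: "strict_mono r"
    "\<And>\<alpha>. \<alpha> \<in> F \<Longrightarrow> \<exists>l. (\<lambda>k. \<alpha> ^ r k) \<longlonglongrightarrow> l"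
    by auto
  have "\<forall>k. (\<lambda>k. \<beta> ^ r k) k \<in> cball 0 1"
    using insert.prems by (simp add: norm_power)
  then obtain l s where s: "strict_mono (s :: nat \<Rightarrow> nat)" "((\<lambda>k. \<beta> ^ r k) \<circ> s) \<longlonglongrightarrow> l"
    using compact_cball [of "0::complex" 1] unfolding compact_def by metis
  have "\<exists>l. (\<lambda>k. \<alpha> ^ (r \<circ> s) k) \<longlonglongrightarrow> l" if "\<alpha> \<in> F" for \<alpha>
    using r(2) [OF that] LIMSEQ_subseq_LIMSEQ [OF _ s(1)] by (fastforce simp: o_def)
  moreover have "(\<lambda>k. \<beta> ^ (r \<circ> s) k) \<longlonglongrightarrow> l"
    using s(2) by (simp add: o_def)
  ultimately show ?case
    using strict_mono_o [OF r(1) s(1)] by blast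
qed

text \<open>If the powers \<open>\<alpha>\<^sup>r\<close> converge along a subsequence \<open>r(k)\<close>, then the quotients
  \<open>\<alpha> ^ r(2 k) / \<alpha> ^ r(k)\<close> tend to \<open>1\<close>, and their exponents \<open>r(2 k) - r(k)\<close> are at least \<open>k\<close>.\<close>

lemma unit_powers_recurrent:
  assumes "finite F" "\<And>\<alpha>. \<alpha> \<in> F \<Longrightarrow> norm \<alpha> = (1::real)"
  shows "\<exists>s :: nat \<Rightarrow> nat. filterlim s at_top sequentially \<and>
    (\<forall>\<alpha>\<in>F. (\<lambda>k. (\<alpha> :: complex) ^ s k) \<longlonglongrightarrow> 1)"
proof -
  obtain r :: "nat \<Rightarrow> nat" where r: "strict_mono r" and
    lim: "\<And>\<alpha>. \<alpha> \<in> F \<Longrightarrow> \<exists>l. (\<lambda>k. \<alpha> ^ r k) \<longlonglongrightarrow> l"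
    using unit_powers_converge_along_subsequence [OF assms] by blast
  define s where "s k = r (2 * k) - r k" for k
  have gap: "r i + k \<le> r (i + k)" for i k
    using strict_mono_leD [OF r] r
    by (induction k) (auto intro: order.trans [OF _ Suc_leI] simp: strict_mono_Suc_iff)
  have "k \<le> s k" for k
    using gap [of k k] by (simp add: s_def mult_2)
  then have "filterlim s at_top sequentially"
    by (intro filterlim_at_top_mono [OF filterlim_ident]) simp
  moreover have "(\<lambda>k. \<alpha> ^ s k) \<longlonglongrightarrow> 1" if \<alpha>: "\<alpha> \<in> F" for \<alpha>
  proof -
    obtain l where l: "(\<lambda>k. \<alpha> ^ r k) \<longlonglongrightarrow> l"
      using lim [OF \<alpha>] by blast
    have "norm l = 1"
      using LIMSEQ_unique [OF tendsto_norm [OF l]] assms(2) [OF \<alpha>] by (simp add: norm_power)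
    then have "l \<noteq> 0" by auto
    have "(\<lambda>k. \<alpha> ^ r (2 * k)) \<longlonglongrightarrow> l"
      using LIMSEQ_subseq_LIMSEQ [OF l, of "\<lambda>k. 2 * k"] by (simp add: o_def strict_mono_def)
    from tendsto_divide [OF this l \<open>l \<noteq> 0\<close>] \<open>l \<noteq> 0\<close>
    have "(\<lambda>k. \<alpha> ^ r (2 * k) / \<alpha> ^ r k) \<longlonglongrightarrow> 1" by simp
    moreover have "\<alpha> \<noteq> 0"
      using assms(2) [OF \<alpha>] by auto
    moreover have "r k \<le> r (2 * k)" for k
      by (simp add: strict_mono_leD [OF r])
    ultimately show ?thesis
      by (simp add: s_def power_diff)
  qed
  ultimately show ?thesis by blast
qed

section \<open>The minimal dilation\<close>

text \<open>Polarisation: the real part of the inner product is determined by the norm, the imaginary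
  part by the real part after multiplication by \<open>\<i>\<close>.\<close>

lemma isometric_embedding_adjoint:
  assumes V: "isometric_embedding V"
  shows "cadj V o\<^sub>L V = id_blinfun"
proof (rule blinfun_eqI, rule cinner_right_eqI)
  have Vo: "V \<in> bounded_ops" and norm_V: "\<And>x. norm (V x) = norm x"
    using V by (auto simp: isometric_embedding_def)
  have Re_eq: "Re (cinner (V x) (V y)) = Re (cinner x y)" for x y
    using norm_add_sq [of "V x" "V y"] norm_add_sq [of x y] norm_V [of "x + y"]
    by (simp add: norm_V blinfun.add_right)
  fix x y
  have "cinner (V x) (V y) = cinner x y"
    using Re_eq [of x y] Re_eq [of x "\<i> *\<^sub>C y"]
    by (simp add: bounded_opsD [OF Vo] cinner_scaleC_right complex_eq_iff)
  then show "cinner x ((cadj V o\<^sub>L V) y) = cinner x (id_blinfun y)"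
    by (simp add: cinner_cadj [OF Vo])
qed

locale dilation =
  fixes A :: "('h::complex_hilbert_space \<Rightarrow>\<^sub>L 'h) set"
    and \<tau> :: "('h \<Rightarrow>\<^sub>L 'h) \<Rightarrow> 'h \<Rightarrow>\<^sub>L 'h"
    and V :: "'h \<Rightarrow>\<^sub>L 'k::complex_hilbert_space"
    and B :: "('k \<Rightarrow>\<^sub>L 'k) set"
    and \<theta> :: "('k \<Rightarrow>\<^sub>L 'k) \<Rightarrow> 'k \<Rightarrow>\<^sub>L 'k"
  assumes vna_A: "von_neumann_algebra A"
    and ucp: "normal_ucp_map A \<tau>"
    and dil: "minimal_dilation A \<tau> V B \<theta>"
begin

lemma vna_B: "von_neumann_algebra B"
  and endo: "normal_unital_star_endomorphism B \<theta>"
  and isometric_V: "isometric_embedding V"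
  and tau_dilation: "x \<in> A \<Longrightarrow> (\<tau> ^^ n) x = compress V ((\<theta> ^^ n) (ident V x))"
  using dil by (auto simp: minimal_dilation_def)

lemma V_bounded_ops [simp]: "V \<in> bounded_ops"
  and V_norm [simp]: "norm (V h) = norm h"
  using isometric_V by (auto simp: isometric_embedding_def)

lemma V_adj_V: "cadj V o\<^sub>L V = id_blinfun"
  by (rule isometric_embedding_adjoint [OF isometric_V])

lemma V_adj_V_apply [simp]: "cadj V (V h) = h"
  using V_adj_V by (metis blinfun_apply_blinfun_compose id_blinfun.rep_eq)

lemma A_bounded_ops [simp]: "x \<in> A \<Longrightarrow> x \<in> bounded_ops"
  by (rule vna_bounded_ops [OF vna_A])

lemma B_bounded_ops [simp]: "x \<in> B \<Longrightarrow> x \<in> bounded_ops"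
  by (rule vna_bounded_ops [OF vna_B])

lemma theta_in: "z \<in> B \<Longrightarrow> \<theta> z \<in> B"
  and theta_compose: "y \<in> B \<Longrightarrow> z \<in> B \<Longrightarrow> \<theta> (y o\<^sub>L z) = \<theta> y o\<^sub>L \<theta> z"
  and theta_cadj: "z \<in> B \<Longrightarrow> \<theta> (cadj z) = cadj (\<theta> z)"
  and theta_add: "y \<in> B \<Longrightarrow> z \<in> B \<Longrightarrow> \<theta> (y + z) = \<theta> y + \<theta> z"
  and theta_scaleC: "z \<in> B \<Longrightarrow> \<theta> (c *\<^sub>C z) = c *\<^sub>C \<theta> z"
  using endo unfolding normal_unital_star_endomorphism_def clinear_on_def by blast+

lemma theta_pow_in: "z \<in> B \<Longrightarrow> (\<theta> ^^ n) z \<in> B"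
  by (induction n) (simp_all add: theta_in)

lemma theta_pow_compose:
  "y \<in> B \<Longrightarrow> z \<in> B \<Longrightarrow> (\<theta> ^^ n) (y o\<^sub>L z) = (\<theta> ^^ n) y o\<^sub>L (\<theta> ^^ n) z"
  by (induction n) (simp_all add: theta_compose theta_pow_in)

lemma theta_pow_cadj: "z \<in> B \<Longrightarrow> (\<theta> ^^ n) (cadj z) = cadj ((\<theta> ^^ n) z)"
  by (induction n) (simp_all add: theta_cadj theta_pow_in)

lemma theta_pow_add: "y \<in> B \<Longrightarrow> z \<in> B \<Longrightarrow> (\<theta> ^^ n) (y + z) = (\<theta> ^^ n) y + (\<theta> ^^ n) z"
  by (induction n) (simp_all add: theta_add theta_pow_in)

lemma theta_pow_scaleC: "z \<in> B \<Longrightarrow> (\<theta> ^^ n) (c *\<^sub>C z) = c *\<^sub>C (\<theta> ^^ n) z"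
  by (induction n) (simp_all add: theta_scaleC theta_pow_in)

lemma theta_pow_norm_le: "z \<in> B \<Longrightarrow> norm ((\<theta> ^^ n) z) \<le> norm z"
proof (induction n)
  case (Suc n)
  then show ?case
    using star_endomorphism_norm_le [OF vna_B endo theta_pow_in [OF Suc.prems]]
    by (auto intro: order_trans)
qed simp

lemma theta_pow_add_exp: "(\<theta> ^^ m) ((\<theta> ^^ n) z) = (\<theta> ^^ (m + n)) z"
  by (simp add: funpow_add)

lemma ident_in: "x \<in> A \<Longrightarrow> ident V x \<in> B"
proof -
  assume x: "x \<in> A"
  have "ident V x \<in> {(\<theta> ^^ n) (ident V x) | n x. x \<in> A}"
    using x by (auto intro!: exI [of _ "0::nat"])
  moreover have "B = generated_vna {(\<theta> ^^ n) (ident V x) | n x. x \<in> A}"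
    using dil by (simp add: minimal_dilation_def)
  ultimately show ?thesis
    unfolding generated_vna_def by blast
qed

lemma ident_apply: "ident V x v = V (x (cadj V v))"
  by (simp add: ident_def)

lemma compress_apply: "compress V z h = cadj V (z (V h))"
  by (simp add: compress_def)

lemma compress_ident [simp]: "compress V (ident V x) = x"
  by (rule blinfun_eqI) (simp add: ident_apply compress_apply)

lemma ident_compose: "ident V (x o\<^sub>L y) = ident V x o\<^sub>L ident V y"
  by (rule blinfun_eqI) (simp add: ident_apply)

lemma ident_compress:
  "ident V (compress V z) = ident V id_blinfun o\<^sub>L z o\<^sub>L ident V id_blinfun"
  by (rule blinfun_eqI) (simp add: ident_apply compress_apply)

lemma ident_scaleC: "ident V (c *\<^sub>C x) = c *\<^sub>C ident V x"
  by (rule blinfun_eqI) (simp add: ident_apply scaleC_blinfun.rep_eq bounded_opsD)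

lemma compress_in:
  assumes "z \<in> B"
  shows "compress V z \<in> A"
proof -
  have "ident V id_blinfun o\<^sub>L z o\<^sub>L ident V id_blinfun \<in> ident V ` A"
    using dil assms by (simp add: minimal_dilation_def)
  then obtain x where "x \<in> A" "ident V (compress V z) = ident V x"
    by (auto simp: ident_compress)
  then show ?thesis
    by (metis compress_ident)
qed

lemma norm_ident_le: "norm (ident V x) \<le> norm x"
proof (rule norm_blinfun_bound)
  fix v
  have "(norm (cadj V v))\<^sup>2 = Re (cinner (V (cadj V v)) v)"
    by (simp add: cinner_cadj cinner_self)
  also have "\<dots> \<le> norm (cadj V v) * norm v"
    using Re_cinner_le [of "V (cadj V v)" v] by simp
  finally have "norm (cadj V v) * norm (cadj V v) \<le> norm (cadj V v) * norm v"
    by (simp add: power2_eq_square)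
  then have "norm (cadj V v) \<le> norm v"
    by (cases "norm (cadj V v) = 0") (auto simp: mult_le_cancel_left)
  then have "norm x * norm (cadj V v) \<le> norm x * norm v"
    by (intro mult_left_mono) auto
  then show "norm (ident V x v) \<le> norm x * norm v"
    using norm_blinfun [of x "cadj V v"] by (simp add: ident_apply)
qed simp

lemma tau_pow_in: "x \<in> A \<Longrightarrow> (\<tau> ^^ n) x \<in> A"
  using ucp by (induction n) (auto simp: normal_ucp_map_def)

lemma tau_pow_eigenvector:
  assumes "x \<in> A" "\<tau> x = \<alpha> *\<^sub>C x"
  shows "(\<tau> ^^ n) x = \<alpha> ^ n *\<^sub>C x"
proof (induction n)
  case (Suc n)
  then show ?case
    using ucp assms
    by (simp add: normal_ucp_map_def clinear_on_def scaleC_scaleC mult.commute)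
qed simp

definition P :: "nat \<Rightarrow> 'k \<Rightarrow>\<^sub>L 'k"
  where "P n = (\<theta> ^^ n) (ident V id_blinfun)"

lemma P_in: "P n \<in> B"
  unfolding P_def by (intro theta_pow_in ident_in vna_id vna_A)

lemma projection_P: "projection_op (P n)"
proof -
  have p: "ident V id_blinfun \<in> B"
    by (intro ident_in vna_id vna_A)
  have "cadj (ident V id_blinfun) = ident V id_blinfun"
    by (rule cadj_unique) (simp add: ident_apply cinner_cadj cinner_cadj_left)
  then have "cadj (P n) = P n"
    unfolding P_def by (metis theta_pow_cadj p)
  moreover have "P n o\<^sub>L P n = P n"
    unfolding P_def by (simp flip: theta_pow_compose ident_compose add: p)
  ultimately show ?thesis
    using P_in by (simp add: projection_op_def)
qed

text \<open>Since \<open>\<tau>\<close> is unital, \<open>\<theta>(p)\<close> preserves the norm of the vectors in the range of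
  \<open>p\<close>, hence fixes them.\<close>

lemma P_Suc_compose: "P (Suc n) o\<^sub>L P n = P n"
proof -
  have one: "id_blinfun \<in> A"
    by (rule vna_id [OF vna_A])
  have "compress V (P (Suc 0)) = id_blinfun"
    using tau_dilation [OF one, of "Suc 0"] ucp by (simp add: P_def normal_ucp_map_def)
  have "P (Suc 0) (V h) = V h" for h
  proof -
    have "complex_of_real ((norm (P (Suc 0) (V h)))\<^sup>2) = cinner (V h) (P (Suc 0) (V h))"
      by (metis cinner_self projection_P projection_op_apply_idem projection_op_cinner)
    also have "\<dots> = cinner h (compress V (P (Suc 0)) h)"
      by (simp add: compress_apply cinner_cadj)
    also have "\<dots> = complex_of_real ((norm h)\<^sup>2)"
      by (simp add: \<open>compress V (P (Suc 0)) = id_blinfun\<close> cinner_self)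
    finally have "(norm (P (Suc 0) (V h)))\<^sup>2 = (norm (V h))\<^sup>2"
      by (simp only: of_real_eq_iff V_norm)
    then show ?thesis
      using projection_op_norm_diff_sq [OF projection_P, of "V h" "Suc 0"] by simp
  qed
  then have "P (Suc 0) o\<^sub>L P 0 = P 0"
    by (intro blinfun_eqI) (simp add: P_def ident_apply)
  then have "(\<theta> ^^ n) (P (Suc 0)) o\<^sub>L (\<theta> ^^ n) (P 0) = (\<theta> ^^ n) (P 0)"
    by (metis theta_pow_compose P_in)
  then show ?thesis
    by (simp add: P_def funpow_swap1)
qed

lemma P_compose:
  assumes "m \<le> n"
  shows "P n o\<^sub>L P m = P m"
  using assms
proof (induction n rule: dec_induct)
  case base
  show ?case
    using projection_P by (simp add: projection_op_def)
next
  case (step n)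
  then show ?case
    by (metis P_Suc_compose compose_assoc)
qed

lemma P_fixes_words:
  assumes "\<forall>i. x i \<in> A" "n \<le> m"
  shows "P m (dilation_word V \<theta> x n (V h)) = dilation_word V \<theta> x n (V h)"
proof -
  have P: "P n (dilation_word V \<theta> x n (V h)) = dilation_word V \<theta> x n (V h)"
  proof (cases n)
    case 0
    then show ?thesis by (simp add: P_def ident_apply)
  next
    case (Suc k)
    have "ident V id_blinfun o\<^sub>L ident V (x n) = ident V (x n)"
      by (simp flip: ident_compose)
    then have "P n o\<^sub>L (\<theta> ^^ n) (ident V (x n)) = (\<theta> ^^ n) (ident V (x n))"
      unfolding P_def using assms(1) by (metis theta_pow_compose ident_in vna_id vna_A)
    then have "P n o\<^sub>L dilation_word V \<theta> x n = dilation_word V \<theta> x n"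
      using Suc by (simp only: dilation_word.simps compose_assoc [symmetric])
    then show ?thesis
      by (metis blinfun_apply_blinfun_compose)
  qed
  show ?thesis
    by (metis P P_compose [OF assms(2)] blinfun_apply_blinfun_compose)
qed

text \<open>The words of length at most \<open>n\<close> lie in the range of \<open>\<theta>\<^sup>n(p)\<close>, and the words are total by
  minimality.\<close>

lemma P_tendsto: "(\<lambda>n. P n v) \<longlonglongrightarrow> v"
proof -
  interpret C: vector_space "scaleC :: complex \<Rightarrow> 'k \<Rightarrow> 'k"
    by (rule vector_space_scaleC)
  let ?W = "{dilation_word V \<theta> x n (V h) | x n h. \<forall>i. x i \<in> A}"
  have "C.span ?W \<subseteq> {w. \<exists>N. \<forall>n\<ge>N. P n w = w}"
  proof (rule C.span_minimal)
    show "?W \<subseteq> {w. \<exists>N. \<forall>n\<ge>N. P n w = w}"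
    proof safe
      fix x :: "nat \<Rightarrow> 'h \<Rightarrow>\<^sub>L 'h" and n h
      assume "\<forall>i. x i \<in> A"
      then show "\<exists>N. \<forall>m\<ge>N. P m (dilation_word V \<theta> x n (V h)) = dilation_word V \<theta> x n (V h)"
        by (intro exI [of _ n]) (simp add: P_fixes_words)
    qed
    show "C.subspace {w. \<exists>N. \<forall>n\<ge>N. P n w = w}"
    proof (rule C.subspaceI)
      fix v w
      assume "v \<in> {w. \<exists>N. \<forall>n\<ge>N. P n w = w}" "w \<in> {w. \<exists>N. \<forall>n\<ge>N. P n w = w}"
      then obtain M N where "\<forall>n\<ge>M. P n v = v" "\<forall>n\<ge>N. P n w = w" by blast
      then have "\<forall>n\<ge>max M N. P n (v + w) = v + w"
        by (simp add: blinfun.add_right)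
      then show "v + w \<in> {w. \<exists>N. \<forall>n\<ge>N. P n w = w}" by blast
    next
      fix c w
      assume "w \<in> {w. \<exists>N. \<forall>n\<ge>N. P n w = w}"
      then show "c *\<^sub>C w \<in> {w. \<exists>N. \<forall>n\<ge>N. P n w = w}"
        using bounded_opsD [OF B_bounded_ops [OF P_in]] by auto
    qed auto
  qed
  moreover have "v \<in> closure (C.span ?W)"
    using dil by (simp add: minimal_dilation_def cspan_def)
  ultimately have v: "v \<in> closure {w. \<exists>N. \<forall>n\<ge>N. P n w = w}"
    using closure_mono by blast
  show ?thesis
  proof (rule metric_LIMSEQ_I)
    fix e :: real
    assume "0 < e"
    then obtain w N where w: "dist w v < e / 2" and N: "\<And>n. n \<ge> N \<Longrightarrow> P n w = w"
      using v [unfolded closure_approachable, rule_format, of "e / 2"] by auto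
    have "dist (P n v) v < e" if "n \<ge> N" for n
    proof -
      have "dist (P n v) (P n w) \<le> dist v w"
        using projection_op_norm_le [OF projection_P, of n "v - w"]
        by (simp add: dist_norm blinfun.diff_right)
      then show ?thesis
        using w N [OF that] dist_triangle [of "P n v" v w] by (simp add: dist_commute)
    qed
    then show "\<exists>N. \<forall>n\<ge>N. dist (P n v) v < e" by blast
  qed
qed

lemma P_norm: "norm (P n) \<le> 1"
  by (rule norm_blinfun_bound) (simp_all add: projection_op_norm_le [OF projection_P])

text \<open>The comparison starts at \<open>p\<^sub>1\<close> because it is applied to images under \<open>\<theta>\<close>: the corner of
  \<open>\<theta> z\<close> at \<open>p\<^sub>n\<^sub>+\<^sub>1 = \<theta>(p\<^sub>n)\<close> is the image of the corner of \<open>z\<close> at \<open>p\<^sub>n\<close>.\<close>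

lemma eq_if_corners_eq:
  assumes "\<And>n. P (Suc n) o\<^sub>L y o\<^sub>L P (Suc n) = P (Suc n) o\<^sub>L z o\<^sub>L P (Suc n)"
  shows "y = z"
proof (rule blinfun_eqI)
  fix v
  have lim: "(\<lambda>n. (P (Suc n) o\<^sub>L w o\<^sub>L P (Suc n)) v) \<longlonglongrightarrow> w v" for w
  proof -
    have P_Suc: "(\<lambda>n. P (Suc n) u) \<longlonglongrightarrow> id_blinfun u" for u
      using LIMSEQ_Suc [OF P_tendsto] by simp
    have "(\<lambda>n. w (P (Suc n) v)) \<longlonglongrightarrow> w v"
      using blinfun.tendsto [OF tendsto_const P_Suc [of v]] by simp
    from tendsto_blinfun_apply_strong [OF P_Suc P_norm this]
    show ?thesis by simp
  qed
  show "y v = z v"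
    using LIMSEQ_unique [OF lim [of y]] lim [of z] by (simp add: assms)
qed

section \<open>Lifting eigenvectors\<close>

definition rotated :: "complex \<Rightarrow> ('h \<Rightarrow>\<^sub>L 'h) \<Rightarrow> nat \<Rightarrow> 'k \<Rightarrow>\<^sub>L 'k"
  where "rotated \<alpha> x n = inverse \<alpha> ^ n *\<^sub>C (\<theta> ^^ n) (ident V x)"

lemma rotated_in: "x \<in> A \<Longrightarrow> rotated \<alpha> x n \<in> B"
  unfolding rotated_def by (intro vna_scaleC vna_B theta_pow_in ident_in)

lemma norm_rotated_le:
  assumes "x \<in> A" "norm \<alpha> = 1"
  shows "norm (rotated \<alpha> x n) \<le> norm x"
proof (rule norm_blinfun_bound)
  fix v :: 'k
  have "norm ((\<theta> ^^ n) (ident V x)) \<le> norm x"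
    by (rule order_trans [OF theta_pow_norm_le [OF ident_in [OF assms(1)]] norm_ident_le])
  then have "norm ((\<theta> ^^ n) (ident V x)) * norm v \<le> norm x * norm v"
    by (rule mult_right_mono) simp
  then have "norm ((\<theta> ^^ n) (ident V x) v) \<le> norm x * norm v"
    by (rule order_trans [OF norm_blinfun])
  then show "norm (rotated \<alpha> x n v) \<le> norm x * norm v"
    by (simp add: rotated_def scaleC_blinfun.rep_eq norm_scaleC norm_power norm_inverse assms(2))
qed simp

text \<open>The martingale property: \<open>p\<^sub>m \<theta>\<^sup>n(x) p\<^sub>m = \<theta>\<^sup>m(p \<theta>\<^sup>n\<^sup>-\<^sup>m(x) p) = \<theta>\<^sup>m(\<tau>\<^sup>n\<^sup>-\<^sup>m(x))\<close>.\<close>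

lemma rotated_corner:
  assumes x: "x \<in> A" "\<tau> x = \<alpha> *\<^sub>C x" and \<alpha>: "\<alpha> \<noteq> 0" and "m \<le> n"
  shows "P m o\<^sub>L rotated \<alpha> x n o\<^sub>L P m = rotated \<alpha> x m"
proof -
  define k where "k = n - m"
  have n: "n = m + k"
    using \<open>m \<le> n\<close> by (simp add: k_def)
  let ?p = "ident V id_blinfun" and ?y = "(\<theta> ^^ k) (ident V x)"
  have in_B: "?p \<in> B" "?y \<in> B" "ident V x \<in> B"
    using vna_id [OF vna_A] x by (simp_all add: ident_in theta_pow_in)
  have "?p o\<^sub>L ?y o\<^sub>L ?p = ident V (\<alpha> ^ k *\<^sub>C x)"
    by (metis ident_compress tau_dilation tau_pow_eigenvector x)
  then have corner: "?p o\<^sub>L ?y o\<^sub>L ?p = \<alpha> ^ k *\<^sub>C ident V x"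
    by (simp add: ident_scaleC)
  have "P m o\<^sub>L (\<theta> ^^ n) (ident V x) o\<^sub>L P m = (\<theta> ^^ m) (?p o\<^sub>L ?y o\<^sub>L ?p)"
    using in_B vna_compose [OF vna_B] by (simp add: P_def n theta_pow_compose theta_pow_add_exp)
  also have "\<dots> = \<alpha> ^ k *\<^sub>C (\<theta> ^^ m) (ident V x)"
    by (simp add: corner theta_pow_scaleC in_B)
  finally have "P m o\<^sub>L rotated \<alpha> x n o\<^sub>L P m
      = (inverse \<alpha> ^ n * \<alpha> ^ k) *\<^sub>C (\<theta> ^^ m) (ident V x)"
    using P_in by (simp add: rotated_def compose_scaleC_left compose_scaleC_right scaleC_scaleC)
  also have "inverse \<alpha> ^ n * \<alpha> ^ k = inverse \<alpha> ^ m"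
    using \<alpha> by (simp add: n power_add power_inverse)
  finally show ?thesis
    by (simp add: rotated_def)
qed

text \<open>The limit \<open>z\<close> of the martingale satisfies \<open>\<theta> z = \<alpha> z\<close> by comparison of corners: the
  corner of \<open>\<theta> z\<close> at \<open>p\<^sub>m\<^sub>+\<^sub>1\<close> is \<open>\<theta>\<close> of the corner of \<open>z\<close> at \<open>p\<^sub>m\<close>, that is \<open>\<theta>(X\<^sub>m) = \<alpha> X\<^sub>m\<^sub>+\<^sub>1\<close>.\<close>

lemma eigenvector_lift:
  assumes x: "x \<in> A" "\<tau> x = \<alpha> *\<^sub>C x" and \<alpha>: "norm \<alpha> = 1"
  obtains z :: "'k \<Rightarrow>\<^sub>L 'k" where "z \<in> B" "\<theta> z = \<alpha> *\<^sub>C z" "compress V z = x"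
    "\<And>v. (\<lambda>n. rotated \<alpha> x n v) \<longlonglongrightarrow> z v"
proof -
  have "\<alpha> \<noteq> 0"
    using \<alpha> by auto
  note corner = rotated_corner [OF x this]
  have "\<exists>z\<in>bounded_ops. \<forall>v. (\<lambda>n. rotated \<alpha> x n v) \<longlonglongrightarrow> z v"
    using projection_P P_compose P_tendsto B_bounded_ops [OF rotated_in [OF x(1)]]
      norm_rotated_le [OF x(1) \<alpha>] corner
    by (rule operator_martingale_converges)
  then obtain z :: "'k \<Rightarrow>\<^sub>L 'k" where lim: "\<And>v. (\<lambda>n. rotated \<alpha> x n v) \<longlonglongrightarrow> z v"
    by blast
  have z: "z \<in> B"
    using vna_B rotated_in [OF x(1)] lim by (rule vna_strong_limit)
  have z_corner: "P m o\<^sub>L z o\<^sub>L P m = rotated \<alpha> x m" for m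
  proof (rule blinfun_eqI)
    fix v
    have "(\<lambda>n. P m (rotated \<alpha> x n (P m v))) \<longlonglongrightarrow> P m (z (P m v))"
      by (intro blinfun.tendsto tendsto_const lim)
    moreover
    have "\<forall>\<^sub>F n in sequentially. P m (rotated \<alpha> x n (P m v)) = rotated \<alpha> x m v"
      using eventually_ge_at_top [of m]
    proof eventually_elim
      case (elim n)
      show ?case
        unfolding corner [OF elim, symmetric] by simp
    qed
    then have "(\<lambda>n. P m (rotated \<alpha> x n (P m v))) \<longlonglongrightarrow> rotated \<alpha> x m v"
      by (rule tendsto_eventually)
    ultimately have "P m (z (P m v)) = rotated \<alpha> x m v"
      by (rule LIMSEQ_unique)
    then show "(P m o\<^sub>L z o\<^sub>L P m) v = rotated \<alpha> x m v"
      by simp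
  qed
  have "\<theta> z = \<alpha> *\<^sub>C z"
  proof (rule eq_if_corners_eq)
    fix m
    have "P (Suc m) o\<^sub>L \<theta> z o\<^sub>L P (Suc m) = \<theta> (P m o\<^sub>L z o\<^sub>L P m)"
      using theta_pow_compose [of _ _ 1] P_in z vna_compose [OF vna_B] by (simp add: P_def)
    also have "\<dots> = \<alpha> *\<^sub>C rotated \<alpha> x (Suc m)"
      using x(1) \<open>\<alpha> \<noteq> 0\<close>
      by (simp add: z_corner rotated_def scaleC_scaleC theta_scaleC theta_pow_in ident_in
          mult.assoc [symmetric])
    also have "\<dots> = P (Suc m) o\<^sub>L (\<alpha> *\<^sub>C z) o\<^sub>L P (Suc m)"
      using P_in by (simp add: z_corner [symmetric] compose_scaleC_left compose_scaleC_right)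
    finally show "P (Suc m) o\<^sub>L \<theta> z o\<^sub>L P (Suc m) = P (Suc m) o\<^sub>L (\<alpha> *\<^sub>C z) o\<^sub>L P (Suc m)" .
  qed
  moreover have "compress V z = x"
    using z_corner [of 0] by (metis P_def compress_ident funpow_0 ident_compress power_0 rotated_def scaleC_one)
  ultimately show thesis
    using that z lim by blast
qed

section \<open>Injectivity of the compression\<close>

abbreviation eigenvectors :: "('k \<Rightarrow>\<^sub>L 'k) set"
  where "eigenvectors \<equiv> {z \<in> B. \<exists>\<alpha>. norm \<alpha> = 1 \<and> \<theta> z = \<alpha> *\<^sub>C z}"

lemma theta_pow_eigenvector: "z \<in> B \<Longrightarrow> \<theta> z = \<alpha> *\<^sub>C z \<Longrightarrow> (\<theta> ^^ n) z = \<alpha> ^ n *\<^sub>C z"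
proof (induction n)
  case (Suc n)
  then show ?case
    using theta_pow_scaleC [of z 1] by (simp add: scaleC_scaleC mult.commute)
qed simp

lemma bounded_linear_scaleC_blinfun: "bounded_linear (\<lambda>z :: 'k \<Rightarrow>\<^sub>L 'k. c *\<^sub>C z)"
proof (rule bounded_linear_intro)
  show "c *\<^sub>C (r *\<^sub>R z) = r *\<^sub>R (c *\<^sub>C z)" for r and z :: "'k \<Rightarrow>\<^sub>L 'k"
    by (simp add: scaleC_of_real [symmetric] scaleC_scaleC mult.commute)
  show "norm (c *\<^sub>C z) \<le> norm z * norm c" for z :: "'k \<Rightarrow>\<^sub>L 'k"
  proof (rule norm_blinfun_bound)
    show "norm ((c *\<^sub>C z) v) \<le> norm z * norm c * norm v" for v
      using mult_left_mono [OF norm_blinfun [of z v], of "norm c"]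
      by (simp add: scaleC_blinfun.rep_eq norm_scaleC mult_ac)
  qed simp
qed (simp add: scaleC_add_right)

lemma tendsto_scaleC_blinfun:
  fixes z :: "'k \<Rightarrow>\<^sub>L 'k"
  assumes "c \<longlonglongrightarrow> 1"
  shows "(\<lambda>k. c k *\<^sub>C z) \<longlonglongrightarrow> z"
proof -
  have "norm (c k *\<^sub>C z - z) \<le> norm (c k - 1) * norm z" for k
  proof (rule norm_blinfun_bound)
    fix v
    have "(c k *\<^sub>C z - z) v = (c k - 1) *\<^sub>C z v"
      using scaleC_add_left [of "c k - 1" 1 "z v"]
      by (simp add: blinfun.diff_left scaleC_blinfun.rep_eq)
    then show "norm ((c k *\<^sub>C z - z) v) \<le> norm (c k - 1) * norm z * norm v"
      using mult_left_mono [OF norm_blinfun [of z v], of "norm (c k - 1)"]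
      by (simp add: norm_scaleC mult.assoc)
  qed simp
  moreover have "(\<lambda>k. norm (c k - 1) * norm z) \<longlonglongrightarrow> 0"
    by (intro tendsto_mult_left_zero tendsto_norm_zero LIM_zero assms)
  ultimately have "(\<lambda>k. c k *\<^sub>C z - z) \<longlonglongrightarrow> 0"
    by (rule Lim_null_comparison [OF always_eventually [OF allI]])
  then show ?thesis
    by (rule LIM_zero_cancel)
qed

text \<open>The eigenvalues \<open>F\<close> involved in \<open>z\<close> control along which sequences of powers of \<open>\<theta>\<close> the
  element \<open>z\<close> returns to itself. Stated for all such sequences, the property passes to sums: the
  union of the two sets of eigenvalues serves both summands at once.\<close>

definition recurrent_with :: "complex set \<Rightarrow> ('k \<Rightarrow>\<^sub>L 'k) \<Rightarrow> bool"
  where "recurrent_with F z \<longleftrightarrow> z \<in> B \<and> finite F \<and> (\<forall>\<alpha>\<in>F. norm \<alpha> = 1) \<and>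
    (\<forall>s. (\<forall>\<alpha>\<in>F. (\<lambda>k. \<alpha> ^ s k) \<longlonglongrightarrow> 1) \<longrightarrow> (\<lambda>k. (\<theta> ^^ s k) z) \<longlonglongrightarrow> z)"

lemma span_eigenvectors_recurrent:
  assumes "z \<in> cspan eigenvectors"
  shows "\<exists>F. recurrent_with F z"
proof -
  interpret C: vector_space "scaleC :: complex \<Rightarrow> ('k \<Rightarrow>\<^sub>L 'k) \<Rightarrow> 'k \<Rightarrow>\<^sub>L 'k"
    by (rule vector_space_scaleC)
  have "C.span eigenvectors \<subseteq> {z. \<exists>F. recurrent_with F z}"
  proof (rule C.span_minimal)
    show "eigenvectors \<subseteq> {z. \<exists>F. recurrent_with F z}"
    proof safe
      fix z \<alpha>
      assume "z \<in> B" "norm \<alpha> = 1" "\<theta> z = \<alpha> *\<^sub>C z"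
      then have "recurrent_with {\<alpha>} z"
        using theta_pow_eigenvector [of z \<alpha>] by (simp add: recurrent_with_def tendsto_scaleC_blinfun)
      then show "\<exists>F. recurrent_with F z" by blast
    qed
    show "C.subspace {z. \<exists>F. recurrent_with F z}"
    proof (rule C.subspaceI)
      have "(0 :: 'k \<Rightarrow>\<^sub>L 'k) \<in> B"
        using vna_scaleC [OF vna_B vna_id [OF vna_B], of 0] by simp
      moreover from this have "(\<theta> ^^ n) 0 = 0" for n
        using theta_pow_scaleC [of 0 n 0] by simp
      ultimately have "recurrent_with {} 0"
        by (simp add: recurrent_with_def)
      then show "0 \<in> {z. \<exists>F. recurrent_with F z}" by blast
    next
      fix y z
      assume "y \<in> {z. \<exists>F. recurrent_with F z}" "z \<in> {z. \<exists>F. recurrent_with F z}"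
      then obtain F G where "recurrent_with F y" "recurrent_with G z" by blast
      then have "recurrent_with (F \<union> G) (y + z)"
        unfolding recurrent_with_def by (auto simp: vna_add [OF vna_B] theta_pow_add intro!: tendsto_add)
      then show "y + z \<in> {z. \<exists>F. recurrent_with F z}" by blast
    next
      fix c z
      assume "z \<in> {z. \<exists>F. recurrent_with F z}"
      then obtain F where "recurrent_with F z" by blast
      then have "recurrent_with F (c *\<^sub>C z)"
        unfolding recurrent_with_def
        by (auto simp: vna_scaleC [OF vna_B] theta_pow_scaleC
            intro!: bounded_linear.tendsto [OF bounded_linear_scaleC_blinfun])
      then show "c *\<^sub>C z \<in> {z. \<exists>F. recurrent_with F z}" by blast
    qed
  qed
  then show ?thesis
    using assms unfolding cspan_def by blast
qed

text \<open>Along a sequence of powers with \<open>\<theta>\<^sup>n(z) \<rightarrow> z\<close> the contractive images \<open>\<theta>\<^sup>n(pzp) =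
  p\<^sub>n \<theta>\<^sup>n(z) p\<^sub>n\<close> converge strongly to \<open>z\<close>.\<close>

lemma norm_le_compress:
  assumes "z \<in> cspan eigenvectors"
  shows "norm z \<le> norm (compress V z)"
proof -
  obtain F :: "complex set" where z: "z \<in> B" and F: "finite F" "\<And>\<alpha>. \<alpha> \<in> F \<Longrightarrow> norm \<alpha> = 1"
    and rec: "\<And>s. (\<forall>\<alpha>\<in>F. (\<lambda>k. \<alpha> ^ s k) \<longlonglongrightarrow> 1) \<Longrightarrow> (\<lambda>k. (\<theta> ^^ s k) z) \<longlonglongrightarrow> z"
    using span_eigenvectors_recurrent [OF assms] unfolding recurrent_with_def by metis
  obtain s where s: "filterlim s at_top sequentially"
    and "\<forall>\<alpha>\<in>F. (\<lambda>k. \<alpha> ^ s k) \<longlonglongrightarrow> 1"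
    using unit_powers_recurrent [OF F] by blast
  then have zs: "(\<lambda>k. (\<theta> ^^ s k) z) \<longlonglongrightarrow> z"
    by (intro rec)
  have Ps: "(\<lambda>k. P (s k) v) \<longlonglongrightarrow> id_blinfun v" for v
    using filterlim_compose [OF P_tendsto s] by simp
  let ?c = "ident V (compress V z)"
  show ?thesis
  proof (rule norm_blinfun_bound)
    fix v
    have "(\<lambda>k. P (s k) ((\<theta> ^^ s k) z (P (s k) v))) \<longlonglongrightarrow> id_blinfun (z (id_blinfun v))"
      by (intro tendsto_blinfun_apply_strong [OF Ps P_norm] blinfun.tendsto zs Ps)
    moreover have "P n ((\<theta> ^^ n) z (P n v)) = (\<theta> ^^ n) ?c v" for n
      unfolding ident_compress P_def
      using theta_pow_compose P_in [of 0] z vna_compose [OF vna_B] by (simp add: P_def)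
    ultimately have "(\<lambda>k. (\<theta> ^^ s k) ?c v) \<longlonglongrightarrow> z v" by simp
    moreover have "norm ((\<theta> ^^ n) ?c v) \<le> norm (compress V z) * norm v" for n
    proof -
      have "norm ((\<theta> ^^ n) ?c) \<le> norm (compress V z)"
        by (rule order_trans [OF theta_pow_norm_le [OF ident_in [OF compress_in [OF z]]] norm_ident_le])
      then show ?thesis
        by (intro order_trans [OF norm_blinfun] mult_right_mono) simp_all
    qed
    ultimately show "norm (z v) \<le> norm (compress V z) * norm v"
      by (intro LIMSEQ_le_const2 [OF tendsto_norm]) auto
  qed simp
qed

lemma compress_diff: "compress V (y - z) = compress V y - compress V z"
  by (rule blinfun_eqI) (simp add: compress_apply blinfun.diff_left blinfun.diff_right)

lemma inj_on_compress: "inj_on (compress V) (peripheral_space B \<theta>)"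
proof (rule inj_onI)
  fix y z
  assume "y \<in> peripheral_space B \<theta>" "z \<in> peripheral_space B \<theta>"
    and eq: "compress V y = compress V z"
  then obtain f g where fg: "\<And>n. f n \<in> cspan eigenvectors" "f \<longlonglongrightarrow> y"
    "\<And>n. g n \<in> cspan eigenvectors" "g \<longlonglongrightarrow> z"
    unfolding peripheral_space_def closure_sequential by blast
  interpret C: vector_space "scaleC :: complex \<Rightarrow> ('k \<Rightarrow>\<^sub>L 'k) \<Rightarrow> 'k \<Rightarrow>\<^sub>L 'k"
    by (rule vector_space_scaleC)
  have "f n - g n \<in> cspan eigenvectors" for n
    using fg C.span_diff unfolding cspan_def by blast
  then have le: "norm (f n - g n) \<le> norm (compress V (f n - g n))" for n
    by (rule norm_le_compress)
  have lim: "(\<lambda>n. f n - g n) \<longlonglongrightarrow> y - z"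
    by (intro tendsto_diff fg)
  have "(\<lambda>n. compress V (f n - g n)) \<longlonglongrightarrow> compress V (y - z)"
    unfolding compress_def
    by (intro bounded_bilinear.tendsto [OF bounded_bilinear_blinfun_compose] tendsto_const lim)
  then have "norm (y - z) \<le> norm (compress V (y - z))"
    using le by (intro LIMSEQ_le [OF tendsto_norm [OF lim] tendsto_norm]) auto
  then show "y = z"
    by (simp add: compress_diff eq)
qed

section \<open>The product\<close>

lemma peripheral_product_eq_compress:
  assumes "y \<in> eigenvectors" "z \<in> eigenvectors"
  shows "peripheral_product V B \<theta> (compress V y) (compress V z) = compress V (y o\<^sub>L z)"
proof -
  interpret C: vector_space "scaleC :: complex \<Rightarrow> ('k \<Rightarrow>\<^sub>L 'k) \<Rightarrow> 'k \<Rightarrow>\<^sub>L 'k"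
    by (rule vector_space_scaleC)
  have "eigenvectors \<subseteq> peripheral_space B \<theta>"
    unfolding peripheral_space_def cspan_def
    using C.span_superset closure_subset by (rule order_trans)
  then show ?thesis
    using assms the_inv_into_f_f [OF inj_on_compress]
    by (simp add: peripheral_product_def subset_iff del: mem_Collect_eq)
qed

lemma tendsto_peripheral_product:
  assumes x: "x \<in> A" "\<tau> x = \<alpha> *\<^sub>C x" "norm \<alpha> = 1"
    and y: "y \<in> A" "\<tau> y = \<mu> *\<^sub>C y" "norm \<mu> = 1"
  shows "(\<lambda>n. (inverse (\<alpha> * \<mu>) ^ n *\<^sub>C (\<tau> ^^ n) (x o\<^sub>L y)) h) \<longlonglongrightarrow> peripheral_product V B \<theta> x y h"
proof -
  obtain a :: "'k \<Rightarrow>\<^sub>L 'k" where a: "a \<in> B" "\<theta> a = \<alpha> *\<^sub>C a" "compress V a = x"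
    and a_lim: "\<And>v. (\<lambda>n. rotated \<alpha> x n v) \<longlonglongrightarrow> a v"
    using eigenvector_lift [OF x] by metis
  obtain b :: "'k \<Rightarrow>\<^sub>L 'k" where b: "b \<in> B" "\<theta> b = \<mu> *\<^sub>C b" "compress V b = y"
    and b_lim: "\<And>v. (\<lambda>n. rotated \<mu> y n v) \<longlonglongrightarrow> b v"
    using eigenvector_lift [OF y] by metis
  have "(\<lambda>n. cadj V (rotated \<alpha> x n (rotated \<mu> y n (V h)))) \<longlonglongrightarrow> cadj V (a (b (V h)))"
    by (intro blinfun.tendsto tendsto_const
        tendsto_blinfun_apply_strong [OF a_lim norm_rotated_le [OF x(1,3)]] b_lim)
  moreover have "cadj V (rotated \<alpha> x n (rotated \<mu> y n (V h)))
      = (inverse (\<alpha> * \<mu>) ^ n *\<^sub>C (\<tau> ^^ n) (x o\<^sub>L y)) h" for n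
  proof -
    have "(\<tau> ^^ n) (x o\<^sub>L y) = compress V ((\<theta> ^^ n) (ident V x) o\<^sub>L (\<theta> ^^ n) (ident V y))"
      using x y by (simp add: tau_dilation vna_compose [OF vna_A] ident_compose theta_pow_compose ident_in)
    then show ?thesis
      using x y theta_pow_in ident_in
      by (simp add: rotated_def scaleC_blinfun.rep_eq compress_apply bounded_opsD scaleC_scaleC
          power_mult_distrib mult.commute)
  qed
  moreover have "peripheral_product V B \<theta> x y = compress V (a o\<^sub>L b)"
    using peripheral_product_eq_compress [of a b] a b x(3) y(3) by auto
  ultimately show ?thesis
    by (simp add: compress_apply)
qed

text \<open>This is the equality case of the Kadison-Schwarz inequality. The operator \<open>c\<close> below is
  \<open>(1 - p) \<theta>(y)\<close> restricted to \<open>\<H>\<close>, since \<open>p \<theta>(y)\<close> acts on \<open>\<H>\<close> as \<open>\<tau>(y) = \<mu> y\<close>. Invariance of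
  \<open>\<phi>\<close> kills \<open>c\<^sup>*c = \<tau>(y\<^sup>*y) - y\<^sup>*y\<close>, so \<open>\<theta>(y)\<close> maps \<open>\<H>\<close> into itself.\<close>

lemma tau_pow_compose_faithful:
  assumes x: "x \<in> A" "\<tau> x = \<alpha> *\<^sub>C x"
    and y: "y \<in> A" "\<tau> y = \<mu> *\<^sub>C y" "norm \<mu> = 1"
    and \<phi>: "faithful_state A \<phi>" "\<And>a. a \<in> A \<Longrightarrow> \<phi> (\<tau> a) = \<phi> a"
  shows "(\<tau> ^^ n) (x o\<^sub>L y) = (\<alpha> * \<mu>) ^ n *\<^sub>C (x o\<^sub>L y)"
proof -
  define b where "b = \<theta> (ident V y)"
  have b: "b \<in> B"
    using theta_pow_in [OF ident_in [OF y(1)], of 1] by (simp add: b_def)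
  have b_corner: "compress V b = \<mu> *\<^sub>C y"
    using tau_dilation [OF y(1), of 1] y(2) by (simp add: b_def)
  define c where "c = (b o\<^sub>L V) - (V o\<^sub>L \<mu> *\<^sub>C y)"
  have c: "c \<in> bounded_ops"
    using b y by (simp add: c_def)
  have yy: "cadj y o\<^sub>L y \<in> A"
    using y(1) by (simp add: vna_compose [OF vna_A] vna_cadj [OF vna_A])
  have c_apply: "c h = b (V h) - \<mu> *\<^sub>C V (y h)" for h
    by (simp add: c_def blinfun.diff_left scaleC_blinfun.rep_eq bounded_opsD)
  have bV_adj: "cadj V (b (V h)) = \<mu> *\<^sub>C y h" for h
    using b_corner by (metis compress_apply scaleC_blinfun.rep_eq)
  have tau_yy: "\<tau> (cadj y o\<^sub>L y) = compress V (cadj b o\<^sub>L b)"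
  proof -
    have "ident V (cadj y) = cadj (ident V y)"
      using y(1) by (intro cadj_unique [symmetric]) (simp add: ident_apply cinner_cadj cinner_cadj_left)
    then show ?thesis
      using tau_dilation [OF yy, of 1] ident_in [OF y(1)] vna_cadj [OF vna_B]
      by (simp add: ident_compose theta_compose theta_cadj b_def)
  qed
  have c_sq: "cadj c o\<^sub>L c = \<tau> (cadj y o\<^sub>L y) - (cadj y o\<^sub>L y)"
  proof (rule blinfun_eqI, rule cinner_right_eqI)
    fix g h
    have \<mu>: "cnj \<mu> * \<mu> = 1"
      using y(3) complex_norm_square [of \<mu>] by (simp add: mult.commute)
    have "cinner h ((cadj c o\<^sub>L c) g) = cinner (c h) (c g)"
      by (simp add: cinner_cadj [OF c])
    also have "\<dots> = cinner (b (V h)) (b (V g)) - \<mu> * cinner (cadj V (b (V h))) (y g)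
        - cnj \<mu> * cinner (y h) (cadj V (b (V g))) + cnj \<mu> * \<mu> * cinner (y h) (y g)"
      by (simp add: c_apply cinner_diff_left cinner_diff_right cinner_scaleC_left
          cinner_scaleC_right cinner_cadj cinner_cadj_left algebra_simps)
    also have "\<dots> = cinner (b (V h)) (b (V g)) - cinner (y h) (y g)"
      using \<mu> by (simp add: bV_adj cinner_scaleC_left cinner_scaleC_right algebra_simps)
    also have "\<dots> = cinner h ((\<tau> (cadj y o\<^sub>L y) - (cadj y o\<^sub>L y)) g)"
      using y(1) b
      by (simp add: tau_yy compress_apply blinfun.diff_left cinner_diff_right cinner_cadj)
    finally show "cinner h ((cadj c o\<^sub>L c) g) = cinner h ((\<tau> (cadj y o\<^sub>L y) - (cadj y o\<^sub>L y)) g)" .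
  qed
  have cc: "cadj c o\<^sub>L c \<in> A"
    unfolding c_sq using vna_diff [OF vna_A] tau_pow_in [OF yy, of 1] yy by simp
  have "\<phi> (cadj c o\<^sub>L c) + \<phi> (cadj y o\<^sub>L y) = \<phi> ((cadj c o\<^sub>L c) + (cadj y o\<^sub>L y))"
    using \<phi>(1) cc yy unfolding faithful_state_def clinear_on_def by metis
  also have "\<dots> = \<phi> (cadj y o\<^sub>L y)"
    by (simp add: c_sq \<phi>(2) [OF yy])
  finally have "\<phi> (cadj c o\<^sub>L c) = 0"
    by simp
  then have "cadj c o\<^sub>L c = 0"
    using \<phi>(1) cc positive_op_cadj_compose [OF c] unfolding faithful_state_def by blast
  then have "c = 0"
    by (rule cadj_compose_eq_zero [OF c])
  then have bV: "b (V h) = \<mu> *\<^sub>C V (y h)" for h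
    using c_apply [of h] by simp
  have "\<tau> (x o\<^sub>L y) = (\<alpha> * \<mu>) *\<^sub>C (x o\<^sub>L y)"
  proof (rule blinfun_eqI)
    fix h
    have "\<tau> (x o\<^sub>L y) = compress V (\<theta> (ident V x) o\<^sub>L b)"
      using tau_dilation [OF vna_compose [OF vna_A x(1) y(1)], of 1] x y
      by (simp add: ident_compose theta_compose ident_in b_def)
    then have "\<tau> (x o\<^sub>L y) h = \<mu> *\<^sub>C compress V (\<theta> (ident V x)) (y h)"
      using x(1) by (simp add: compress_apply bV bounded_opsD theta_in ident_in)
    also have "compress V (\<theta> (ident V x)) = \<alpha> *\<^sub>C x"
      using tau_dilation [OF x(1), of 1] x(2) by simp
    finally show "\<tau> (x o\<^sub>L y) h = ((\<alpha> * \<mu>) *\<^sub>C (x o\<^sub>L y)) h"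
      by (simp add: scaleC_blinfun.rep_eq scaleC_scaleC mult.commute)
  qed
  then show ?thesis
    using tau_pow_eigenvector vna_compose [OF vna_A x(1) y(1)] by blast
qed

end

theorem theorem2p5:
  fixes A :: "('h::{complex_hilbert_space, second_countable_topology} \<Rightarrow>\<^sub>L 'h) set"
    and \<tau> :: "('h \<Rightarrow>\<^sub>L 'h) \<Rightarrow> 'h \<Rightarrow>\<^sub>L 'h"
    and V :: "'h \<Rightarrow>\<^sub>L 'k::{complex_hilbert_space, second_countable_topology}"
    and B :: "('k \<Rightarrow>\<^sub>L 'k) set"
    and \<theta> :: "('k \<Rightarrow>\<^sub>L 'k) \<Rightarrow> 'k \<Rightarrow>\<^sub>L 'k"
    and x y :: "'h \<Rightarrow>\<^sub>L 'h"
    and \<alpha> \<mu> :: complex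
  assumes "von_neumann_algebra A"
    and "normal_ucp_map A \<tau>"
    and "minimal_dilation A \<tau> V B \<theta>"
    and "x \<in> A" and "y \<in> A"
    and "norm \<alpha> = 1" and "norm \<mu> = 1"
    and "\<tau> x = \<alpha> *\<^sub>C x" and "\<tau> y = \<mu> *\<^sub>C y"
  shows "limitin strong_operator_topology
           (\<lambda>n. inverse (\<alpha> * \<mu>) ^ n *\<^sub>C (\<tau> ^^ n) (x o\<^sub>L y))
           (peripheral_product V B \<theta> x y) sequentially
       \<and> ((\<exists>\<phi>. faithful_state A \<phi> \<and> (\<forall>a\<in>A. \<phi> (\<tau> a) = \<phi> a))
           \<longrightarrow> peripheral_product V B \<theta> x y = x o\<^sub>L y)"
proof -
  interpret dilation A \<tau> V B \<theta>
    by (rule dilation.intro [OF assms(1-3)])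
  have lim: "(\<lambda>n. (inverse (\<alpha> * \<mu>) ^ n *\<^sub>C (\<tau> ^^ n) (x o\<^sub>L y)) h)
      \<longlonglongrightarrow> peripheral_product V B \<theta> x y h" for h
    using assms(4-9) by (intro tendsto_peripheral_product)
  have "peripheral_product V B \<theta> x y = x o\<^sub>L y"
    if \<phi>: "faithful_state A \<phi>" "\<forall>a\<in>A. \<phi> (\<tau> a) = \<phi> a" for \<phi>
  proof (rule blinfun_eqI)
    fix h
    have "\<alpha> * \<mu> \<noteq> 0"
      using assms(6,7) by auto
    moreover have "(\<tau> ^^ n) (x o\<^sub>L y) = (\<alpha> * \<mu>) ^ n *\<^sub>C (x o\<^sub>L y)" for n
      using assms(4-9) \<phi> by (intro tau_pow_compose_faithful [of x \<alpha> y \<mu> \<phi>]) auto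
    ultimately have "inverse (\<alpha> * \<mu>) ^ n *\<^sub>C (\<tau> ^^ n) (x o\<^sub>L y) = x o\<^sub>L y" for n
      by (simp add: scaleC_scaleC power_inverse del: inverse_mult_distrib mult_eq_0_iff)
    with lim [of h] show "peripheral_product V B \<theta> x y h = (x o\<^sub>L y) h"
      by (simp only: LIMSEQ_const_iff)
  qed
  then show ?thesis
    using limitin_strong_operator_topologyI [OF lim] by blast
qed

end
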